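(* Consider the load-balancing online multiple knapsack problem with departures (defined in the context), and suppose that $\epsilon_k\le\frac{C_k\ln 2}{q_k\gamma_k}$ for all $k\in K$, where $\gamma_k=2\ln(2+4\bar\theta_k\bar d_k)$. Then Algorithm 2 outputs a feasible (integral) solution and has a competitive ratio of $O\big(\log(\bar\theta^{\max}\cdot\bar d^{\max})\big)$, where $\bar\theta^{\max}=\max_k\bar\theta_k$ and $\bar d^{\max}=\max_k\bar d_k$.
   Context: Problem. Finite set $K$ of resources with capacities $C_k>0$ and given positive integers $q_k$; discrete time horizon $T$; a set $N$ of requests, each with an arrival time $a_n\in T$; requests arrive in batches $N_i=\{n\in N:a_n=i\}$, $i\in T$. For each $n,k$: reward $v_{nk}\ge0$, demand $w_{nk}>0$, start slot $s_{nk}$, integer duration $d_{nk}\ge 1$, $T_{nk}=\{s_{nk},\dots,s_{nk}+d_{nk}-1\}\subseteq T$. When batch $N_i$ arrives, all data of its requests are revealed and the algorithm irrevocably decides for each $n\in N_i$ to reject it or assign it to one resource, without knowledge of future batches. A solution $x\in\{0,1\}^{N\times K}$ is feasible if $\sum_k x_{nk}\le1$ for all $n$, $\sum_{n:\,t\in T_{nk}}w_{nk}x_{nk}\le C_k$ for all $k,t$, and $\sum_{n\in N_i}x_{nk}\le q_k$ for all $k\in K$, $i\in T$; its value is $\sum_{n,k}v_{nk}x_{nk}$. Assumptions: (A1) $\theta_{nk}=\frac{v_{nk}}{w_{nk}d_{nk}}\in[\theta_k^{\min},\theta_k^{\max}]$ whenever $v_{nk}>0$, with $0<\theta_k^{\min}\le\theta_k^{\max}<\infty$,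 and $\theta_k^{\min}$, $\bar\theta_k=\theta_k^{\max}/\theta_k^{\min}$ known; (A2) $d_{nk}\in[d_k^{\min},d_k^{\max}]$, $\bar d_k=d_k^{\max}/d_k^{\min}$ finite and known; (A3) $w_{nk}\le\epsilon_k\le C_k$. Parameters: $\gamma_k=2\ln(2+4\bar\theta_k\bar d_k)$, $\mu_{nk}=e^{w_{nk}\gamma_k/C_k}$, $\beta_{nk}=\theta_k^{\min}(\mu_{nk}-1)$. Algorithm 2: initialize $x=0$, $p_{kt}=0$, $u_n=0$, $h_{ki}=0$. For each time $i\in T$ in order: with the current prices compute $r_{nk}=v_{nk}-w_{nk}\sum_{t\in T_{nk}}p_{kt}$ for $n\in N_i$, $k\in K$. Let $(P_i)$ be the LP: maximize $\sum_{n\in N_i,k\in K: r_{nk}>0}r_{nk}x_{nk}$ subject to $\sum_{n\in N_i}x_{nk}\le q_k$ ($k\in K$), $\sum_k x_{nk}\le1$ ($n\in N_i$), $x\ge0$ (variables only for pairs with $r_{nk}>0$), and $(D_i)$ its dual: minimize $\sum_{n\in N_i}u_n+\sum_k q_kh_{ki}$ subject to $u_n+h_{ki}\ge r_{nk}$ for all $n\in N_i,k$ with $r_{nk}>0$, $u,h\ge0$. Find an optimal integral solution $\bar x$ of $(P_i)$ (one exists since the constraint matrix is totally unimodular) and an optimal solution $(\bar u,\bar h)$ of $(D_i)$. Set $u_n=\bar u_n$ for $n\in N_i$ and $h_{ki}=\bar h_{ki}$ for $k\in K$; for each pair with $\bar x_{nk}=1$, set $x_{nk}=1$ and for each $t\in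 T_{nk}$ update $p_{kt}\leftarrow\mu_{nk}p_{kt}+\beta_{nk}$. Competitive ratio $\alpha$: for every instance satisfying the assumptions, the optimal offline value (maximum value of a feasible integral solution) is at most $\alpha$ times the value of the algorithm's solution. *)

theory Defs
  imports Complex_Main "HOL-Library.Landau_Symbols"
begin

text \<open>
  Requests and resources are labelled by natural numbers (any finite set can be so labelled).  Fixing
  the label types lets a single bound range over all instances: a constant obtained inside a
  polymorphic statement could depend on the type instantiation, hence on the number of resources.
\<close>

record mkp_instance =
  resources :: "nat set"
  requests :: "nat set"
  horizon :: nat
  capacity :: "nat \<Rightarrow> real"
  quota :: "nat \<Rightarrow> nat"
  arrival :: "nat \<Rightarrow> nat"
  reward :: "nat \<Rightarrow> nat \<Rightarrow> real"
  demand :: "nat \<Rightarrow> nat \<Rightarrow> real"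
  start :: "nat \<Rightarrow> nat \<Rightarrow> nat"
  duration :: "nat \<Rightarrow> nat \<Rightarrow> nat"
  theta_min :: "nat \<Rightarrow> real"
  theta_max :: "nat \<Rightarrow> real"
  dur_min :: "nat \<Rightarrow> real"
  dur_max :: "nat \<Rightarrow> real"
  demand_bound :: "nat \<Rightarrow> real"

definition time_slots :: "mkp_instance \<Rightarrow> nat set" where
  "time_slots I = {1..horizon I}"

definition batch :: "mkp_instance \<Rightarrow> nat \<Rightarrow> nat set" where
  "batch I i = {n \<in> requests I. arrival I n = i}"

definition slots :: "mkp_instance \<Rightarrow> nat \<Rightarrow> nat \<Rightarrow> nat set" where
  "slots I n k = {start I n k ..< start I n k + duration I n k}"

definition theta :: "mkp_instance \<Rightarrow> nat \<Rightarrow> nat \<Rightarrow> real" where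
  "theta I n k = reward I n k / (demand I n k * real (duration I n k))"

definition theta_ratio :: "mkp_instance \<Rightarrow> nat \<Rightarrow> real" where
  "theta_ratio I k = theta_max I k / theta_min I k"

definition dur_ratio :: "mkp_instance \<Rightarrow> nat \<Rightarrow> real" where
  "dur_ratio I k = dur_max I k / dur_min I k"

definition theta_ratio_max :: "mkp_instance \<Rightarrow> real" where
  "theta_ratio_max I = Max (theta_ratio I ` resources I)"

definition dur_ratio_max :: "mkp_instance \<Rightarrow> real" where
  "dur_ratio_max I = Max (dur_ratio I ` resources I)"

definition well_formed :: "mkp_instance \<Rightarrow> bool" where
  "well_formed I \<longleftrightarrow>
     finite (resources I) \<and> resources I \<noteq> {} \<and> finite (requests I) \<and>
     (\<forall>k\<in>resources I. capacity I k > 0 \<and> quota I k > 0) \<and>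
     (\<forall>n\<in>requests I. arrival I n \<in> time_slots I) \<and>
     (\<forall>n\<in>requests I. \<forall>k\<in>resources I.
        reward I n k \<ge> 0 \<and> demand I n k > 0 \<and> duration I n k \<ge> 1 \<and> slots I n k \<subseteq> time_slots I)"

definition density_assumption :: "mkp_instance \<Rightarrow> bool" where
  "density_assumption I \<longleftrightarrow>
     (\<forall>k\<in>resources I. 0 < theta_min I k \<and> theta_min I k \<le> theta_max I k) \<and>
     (\<forall>n\<in>requests I. \<forall>k\<in>resources I. reward I n k > 0 \<longrightarrow>
        theta I n k \<in> {theta_min I k..theta_max I k})"

definition duration_assumption :: "mkp_instance \<Rightarrow> bool" where
  "duration_assumption I \<longleftrightarrow>
     (\<forall>k\<in>resources I. 0 < dur_min I k \<and> dur_min I k \<le> dur_max I k) \<and>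
     (\<forall>n\<in>requests I. \<forall>k\<in>resources I.
        real (duration I n k) \<in> {dur_min I k..dur_max I k})"

definition demand_assumption :: "mkp_instance \<Rightarrow> bool" where
  "demand_assumption I \<longleftrightarrow>
     (\<forall>k\<in>resources I. demand_bound I k \<le> capacity I k) \<and>
     (\<forall>n\<in>requests I. \<forall>k\<in>resources I. demand I n k \<le> demand_bound I k)"

definition admissible :: "mkp_instance \<Rightarrow> bool" where
  "admissible I \<longleftrightarrow>
     well_formed I \<and> density_assumption I \<and> duration_assumption I \<and> demand_assumption I"

definition feasible :: "mkp_instance \<Rightarrow> (nat \<Rightarrow> nat \<Rightarrow> real) \<Rightarrow> bool" where
  "feasible I x \<longleftrightarrow>
     (\<forall>n\<in>requests I. \<forall>k\<in>resources I. x n k \<in> {0, 1}) \<and>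
     (\<forall>n\<in>requests I. (\<Sum>k\<in>resources I. x n k) \<le> 1) \<and>
     (\<forall>k\<in>resources I. \<forall>t\<in>time_slots I.
        (\<Sum>n | n \<in> requests I \<and> t \<in> slots I n k. demand I n k * x n k) \<le> capacity I k) \<and>
     (\<forall>k\<in>resources I. \<forall>i\<in>time_slots I. (\<Sum>n\<in>batch I i. x n k) \<le> real (quota I k))"

definition solution_value :: "mkp_instance \<Rightarrow> (nat \<Rightarrow> nat \<Rightarrow> real) \<Rightarrow> real" where
  "solution_value I x = (\<Sum>n\<in>requests I. \<Sum>k\<in>resources I. reward I n k * x n k)"

text \<open>
  Values of a solution outside \<open>requests I \<times> resources I\<close> are unconstrained but do not enter
  \<^const>\<open>solution_value\<close>, so the maximum below is over a finite set.
\<close>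

definition offline_opt :: "mkp_instance \<Rightarrow> real" where
  "offline_opt I = Max (solution_value I ` {x. feasible I x})"

definition gam :: "mkp_instance \<Rightarrow> nat \<Rightarrow> real" where
  "gam I k = 2 * ln (2 + 4 * theta_ratio I k * dur_ratio I k)"

definition mu :: "mkp_instance \<Rightarrow> nat \<Rightarrow> nat \<Rightarrow> real" where
  "mu I n k = exp (demand I n k * gam I k / capacity I k)"

definition beta :: "mkp_instance \<Rightarrow> nat \<Rightarrow> nat \<Rightarrow> real" where
  "beta I n k = theta_min I k * (mu I n k - 1)"

definition reduced_reward :: "mkp_instance \<Rightarrow> (nat \<Rightarrow> nat \<Rightarrow> real) \<Rightarrow> nat \<Rightarrow> nat \<Rightarrow> real" where
  "reduced_reward I p n k = reward I n k - demand I n k * (\<Sum>t\<in>slots I n k. p k t)"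

definition profitable :: "mkp_instance \<Rightarrow> (nat \<Rightarrow> nat \<Rightarrow> real) \<Rightarrow> nat \<Rightarrow> (nat \<times> nat) set" where
  "profitable I p i =
     {(n, k). n \<in> batch I i \<and> k \<in> resources I \<and> reduced_reward I p n k > 0}"

definition primal_feasible ::
    "mkp_instance \<Rightarrow> (nat \<Rightarrow> nat \<Rightarrow> real) \<Rightarrow> nat \<Rightarrow> (nat \<Rightarrow> nat \<Rightarrow> real) \<Rightarrow> bool" where
  "primal_feasible I p i x \<longleftrightarrow>
     (\<forall>k\<in>resources I. (\<Sum>n | (n, k) \<in> profitable I p i. x n k) \<le> real (quota I k)) \<and>
     (\<forall>n\<in>batch I i. (\<Sum>k | (n, k) \<in> profitable I p i. x n k) \<le> 1) \<and>
     (\<forall>(n, k)\<in>profitable I p i. 0 \<le> x n k)"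

definition primal_value ::
    "mkp_instance \<Rightarrow> (nat \<Rightarrow> nat \<Rightarrow> real) \<Rightarrow> nat \<Rightarrow> (nat \<Rightarrow> nat \<Rightarrow> real) \<Rightarrow> real" where
  "primal_value I p i x = (\<Sum>(n, k)\<in>profitable I p i. reduced_reward I p n k * x n k)"

definition primal_optimal ::
    "mkp_instance \<Rightarrow> (nat \<Rightarrow> nat \<Rightarrow> real) \<Rightarrow> nat \<Rightarrow> (nat \<Rightarrow> nat \<Rightarrow> real) \<Rightarrow> bool" where
  "primal_optimal I p i x \<longleftrightarrow>
     primal_feasible I p i x \<and>
     (\<forall>y. primal_feasible I p i y \<longrightarrow> primal_value I p i y \<le> primal_value I p i x)"

definition dual_feasible ::
    "mkp_instance \<Rightarrow> (nat \<Rightarrow> nat \<Rightarrow> real) \<Rightarrow> nat \<Rightarrow> (nat \<Rightarrow> real) \<Rightarrow> (nat \<Rightarrow> real) \<Rightarrow> bool" where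
  "dual_feasible I p i u h \<longleftrightarrow>
     (\<forall>(n, k)\<in>profitable I p i. u n + h k \<ge> reduced_reward I p n k) \<and>
     (\<forall>n\<in>batch I i. 0 \<le> u n) \<and> (\<forall>k\<in>resources I. 0 \<le> h k)"

definition dual_value ::
    "mkp_instance \<Rightarrow> nat \<Rightarrow> (nat \<Rightarrow> real) \<Rightarrow> (nat \<Rightarrow> real) \<Rightarrow> real" where
  "dual_value I i u h = (\<Sum>n\<in>batch I i. u n) + (\<Sum>k\<in>resources I. real (quota I k) * h k)"

definition dual_optimal ::
    "mkp_instance \<Rightarrow> (nat \<Rightarrow> nat \<Rightarrow> real) \<Rightarrow> nat \<Rightarrow> (nat \<Rightarrow> real) \<Rightarrow> (nat \<Rightarrow> real) \<Rightarrow> bool" where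
  "dual_optimal I p i u h \<longleftrightarrow>
     dual_feasible I p i u h \<and>
     (\<forall>u' h'. dual_feasible I p i u' h' \<longrightarrow> dual_value I i u h \<le> dual_value I i u' h')"

record alg_state =
  sol :: "nat \<Rightarrow> nat \<Rightarrow> real"
  price :: "nat \<Rightarrow> nat \<Rightarrow> real"
  req_dual :: "nat \<Rightarrow> real"
  res_dual :: "nat \<Rightarrow> nat \<Rightarrow> real"

definition init_state :: alg_state where
  "init_state = \<lparr>sol = \<lambda>n k. 0, price = \<lambda>k t. 0, req_dual = \<lambda>n. 0, res_dual = \<lambda>k i. 0\<rparr>"

definition price_update ::
    "mkp_instance \<Rightarrow> nat \<times> nat \<Rightarrow> (nat \<Rightarrow> nat \<Rightarrow> real) \<Rightarrow> (nat \<Rightarrow> nat \<Rightarrow> real)" where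
  "price_update I = (\<lambda>(n, k) p k' t.
     if k' = k \<and> t \<in> slots I n k then mu I n k * p k' t + beta I n k else p k' t)"

text \<open>
  The algorithm leaves open which optimal solutions of the two linear programs are taken and in
  which order the accepted pairs (listed by \<open>ps\<close>) are processed, so a step is a relation.
\<close>

definition alg_step :: "mkp_instance \<Rightarrow> nat \<Rightarrow> alg_state \<Rightarrow> alg_state \<Rightarrow> bool" where
  "alg_step I i \<sigma> \<sigma>' \<longleftrightarrow>
     (\<exists>x u h ps.
        primal_optimal I (price \<sigma>) i x \<and>
        (\<forall>(n, k)\<in>profitable I (price \<sigma>) i. x n k \<in> \<int>) \<and>
        dual_optimal I (price \<sigma>) i u h \<and>
        distinct ps \<and> set ps = {(n, k) \<in> profitable I (price \<sigma>) i. x n k = 1} \<and>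
        \<sigma>' = \<lparr>sol = \<lambda>n k. if (n, k) \<in> set ps then 1 else sol \<sigma> n k,
              price = fold (price_update I) ps (price \<sigma>),
              req_dual = \<lambda>n. if n \<in> batch I i then u n else req_dual \<sigma> n,
              res_dual = \<lambda>k j. if k \<in> resources I \<and> j = i then h k else res_dual \<sigma> k j\<rparr>)"

inductive alg_run :: "mkp_instance \<Rightarrow> nat \<Rightarrow> alg_state \<Rightarrow> bool" for I where
  init: "alg_run I 0 init_state"
| step: "alg_run I i \<sigma> \<Longrightarrow> alg_step I (Suc i) \<sigma> \<sigma>' \<Longrightarrow> alg_run I (Suc i) \<sigma>'"

definition alg_output :: "mkp_instance \<Rightarrow> (nat \<Rightarrow> nat \<Rightarrow> real) \<Rightarrow> bool" where
  "alg_output I x \<longleftrightarrow> (\<exists>\<sigma>. alg_run I (horizon I) \<sigma> \<and> x = sol \<sigma>)"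

definition small_demands :: "mkp_instance \<Rightarrow> bool" where
  "small_demands I \<longleftrightarrow>
     (\<forall>k\<in>resources I. demand_bound I k \<le> capacity I k * ln 2 / (real (quota I k) * gam I k))"

definition competitive_ratio :: "mkp_instance set \<Rightarrow> real \<Rightarrow> bool" where
  "competitive_ratio \<I> a \<longleftrightarrow>
     (\<forall>I\<in>\<I>. \<forall>x. alg_output I x \<longrightarrow> offline_opt I \<le> a * solution_value I x)"

end

theory Submission
  imports Defs "HOL-Library.FuncSet"
begin

text \<open>
  Each batch is a weighted bipartite assignment problem with quotas; it has an integral optimum and
  dual prices of the same value, so the algorithm can always proceed.

  The update rule keeps \<open>p k t = theta_min k * (exp (gam k * L / C k) - 1)\<close>, where \<open>L\<close> is the load
  of resource \<open>k\<close> in slot \<open>t\<close>, and by smallness of the demands a single batch multiplies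
  \<open>p k t + theta_min k\<close> by at most 2.

  Feasibility: as soon as the requests covering at least \<open>dur_min / 2\<close> fixed slots use almost half of the
  capacity, the prices of these slots make every further request covering them unprofitable. Every
  request covering a slot \<open>t\<close> covers such a block of slots beginning or ending in \<open>t\<close>, and the two blocks
  together account for at most the full capacity.

  Competitiveness: the variables \<open>u\<close>, \<open>h\<close>, \<open>p\<close> are a feasible solution of the dual of the offline linear
  program, and in each batch its cost grows by at most \<open>1 + 4 * gam\<close> times the accepted reward.
\<close>

section \<open>Duality for the assignment problem with quotas\<close>

lemma sum_fun_upd:
  fixes g :: "'a \<Rightarrow> 'b \<Rightarrow> 'c :: ab_group_add"
  assumes "finite N" "n \<in> N"
  shows "(\<Sum>m\<in>N. g m ((e(n := z)) m)) = (\<Sum>m\<in>N. g m (e m)) - g n (e n) + g n z"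
proof -
  have "(\<Sum>m\<in>N - {n}. g m ((e(n := z)) m)) = (\<Sum>m\<in>N - {n}. g m (e m))"
    by (rule sum.cong) auto
  then show ?thesis using assms by (simp add: sum.remove)
qed

text \<open>
  A list of agents encodes a chain of reassignments of \<open>f\<close>: each agent moves to the current place of the
  next one, the last one moves to \<open>z\<close>.
\<close>

context
  fixes f :: "'a \<Rightarrow> 'b" and w :: "'a \<Rightarrow> 'b \<Rightarrow> real"
begin

fun walk_start :: "'a list \<Rightarrow> 'b \<Rightarrow> 'b" where
  "walk_start [] z = z"
| "walk_start (n # ns) z = f n"

text \<open>The total weight lost by the chain. It stays defined when agents repeat, although it is
  then in general not the effect of \<open>shift\<close>; this keeps costs additive under
  concatenation.\<close>

fun walk_cost :: "'a list \<Rightarrow> 'b \<Rightarrow> real" where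
  "walk_cost [] z = 0"
| "walk_cost (n # ns) z = w n (f n) - w n (walk_start ns z) + walk_cost ns z"

fun shift :: "'a list \<Rightarrow> 'b \<Rightarrow> 'a \<Rightarrow> 'b" where
  "shift [] z = f"
| "shift (n # ns) z = (shift ns z)(n := walk_start ns z)"

lemma walk_start_append: "walk_start (xs @ n # ys) z = walk_start xs (f n)"
  by (cases xs) auto

text \<open>The prefix ends at the place that \<open>n\<close> vacates. With this, closed walks can
  be cut out of longer ones.\<close>

lemma walk_cost_append:
  "walk_cost (xs @ n # ys) z = walk_cost xs (f n) + walk_cost (n # ys) z"
  by (induction xs) (auto simp: walk_start_append)

lemma shift_notin: "n \<notin> set ns \<Longrightarrow> shift ns z n = f n"
  by (induction ns) auto

lemma shift_image: "n \<in> N \<Longrightarrow> set ns \<subseteq> N \<Longrightarrow> shift ns z n \<in> insert z (f ` N)"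
proof (induction ns)
  case (Cons m ns)
  then show ?case by (cases ns) auto
qed simp

text \<open>Distinctness ensures that each agent is still at its old place when its own move is
  applied, so every update changes the sum by exactly one term of the cost.\<close>

lemma sum_shift_weight:
  assumes "finite N" "set ns \<subseteq> N" "distinct ns"
  shows "(\<Sum>n\<in>N. w n (shift ns z n)) = (\<Sum>n\<in>N. w n (f n)) - walk_cost ns z"
  using assms(2,3)
proof (induction ns)
  case (Cons n ns)
  then show ?case using assms(1)
    by (simp add: sum_fun_upd[of N n w] shift_notin del: fun_upd_apply)
qed simp

end

text \<open>Counting is summation of the indicator of \<open>j\<close>. For this weight the cost
  telescopes to the two ends of the chain.\<close>

lemma card_shift:
  assumes "finite N" "set ns \<subseteq> N" "distinct ns"
  shows "real (card {n \<in> N. shift f ns z n = j}) =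
    real (card {n \<in> N. f n = j}) - of_bool (walk_start f ns z = j) + of_bool (z = j)"
proof -
  let ?w = "\<lambda>(_ :: 'a) y. of_bool (y = j) :: real"
  have "walk_cost f ?w ns z = of_bool (walk_start f ns z = j) - of_bool (z = j)"
    by (induction ns) auto
  moreover have "real (card {n \<in> N. e n = j}) = (\<Sum>n\<in>N. ?w n (e n))" for e
    using assms(1) by (simp add: Int_def)
  ultimately show ?thesis
    using sum_shift_weight[OF assms, of ?w f z] by simp
qed

text \<open>
  The price of a resource is the cheapest loss incurred by freeing one unit of it through a chain of
  reassignments ending in a resource with spare capacity; an optimal assignment makes every such
  loss nonnegative. The value \<^const>\<open>None\<close> plays the role of an unbounded resource of weight zero.
\<close>

theorem assignment_duality:
  fixes W :: "'a \<Rightarrow> 'k \<Rightarrow> real" and q :: "'k \<Rightarrow> nat"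
  assumes fin: "finite N" "finite K" and q: "\<And>k. k \<in> K \<Longrightarrow> q k > 0"
  obtains f :: "'a \<Rightarrow> 'k option" and u :: "'a \<Rightarrow> real" and h :: "'k \<Rightarrow> real" where
    "\<And>n. n \<in> N \<Longrightarrow> f n \<in> insert None (Some ` K)"
    "\<And>k. k \<in> K \<Longrightarrow> card {n \<in> N. f n = Some k} \<le> q k"
    "\<And>n. n \<in> N \<Longrightarrow> 0 \<le> u n" "\<And>k. k \<in> K \<Longrightarrow> 0 \<le> h k"
    "\<And>n k. n \<in> N \<Longrightarrow> k \<in> K \<Longrightarrow> W n k \<le> u n + h k"
    "(\<Sum>n\<in>N. case f n of None \<Rightarrow> 0 | Some k \<Rightarrow> W n k) = (\<Sum>n\<in>N. u n) + (\<Sum>k\<in>K. real (q k) * h k)"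
proof -
  define w where "w n j = (case j of None \<Rightarrow> 0 | Some k \<Rightarrow> W n k)" for n and j :: "'k option"
  define J where "J = insert None (Some ` K)"
  \<comment> \<open>Extensional functions make the set of assignments finite, so that an optimal one
    exists.\<close>
  define F where "F = {f \<in> N \<rightarrow>\<^sub>E J. \<forall>k\<in>K. card {n \<in> N. f n = Some k} \<le> q k}"
  define val where "val f = (\<Sum>n\<in>N. w n (f n))" for f :: "'a \<Rightarrow> 'k option"
  have finF: "finite F"
    unfolding F_def J_def by (rule finite_subset[of _ "N \<rightarrow>\<^sub>E insert None (Some ` K)"])
      (use fin in \<open>auto intro!: finite_PiE\<close>)
  have "restrict (\<lambda>_. None) N \<in> F"
    by (auto simp: F_def J_def cong: conj_cong)
  then have "F \<noteq> {}" by blast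
  then obtain f where f: "f \<in> F" and opt: "\<And>g. g \<in> F \<Longrightarrow> val g \<le> val f"
    using finF by (metis (no_types, opaque_lifting) obtains_MAX Max_ge finite_imageI imageI)
  have fJ: "n \<in> N \<Longrightarrow> f n \<in> J" for n using f by (auto simp: F_def)
  have fq: "k \<in> K \<Longrightarrow> card {n \<in> N. f n = Some k} \<le> q k" for k using f by (auto simp: F_def)
  define free where "free = insert None (Some ` {k \<in> K. card {n \<in> N. f n = Some k} < q k})"
  have freeJ: "free \<subseteq> J" by (auto simp: free_def J_def)
  \<comment> \<open>Without repetitions the chain is a genuine reassignment. Only its two end places
    can change their counts, and the last one is free or coincides with the first, so the quotas
    still hold. Optimality of \<open>f\<close> rules out a gain.\<close>
  have simple: "walk_cost f w ns z \<ge> 0"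
    if ns: "set ns \<subseteq> N" "distinct ns" and z: "z \<in> free \<or> z = walk_start f ns z \<and> z \<in> J" for ns z
  proof -
    define g where "g = restrict (shift f ns z) N"
    have "g \<in> F"
      unfolding F_def
    proof (intro CollectI conjI ballI)
      show "g \<in> N \<rightarrow>\<^sub>E J"
        using shift_image[OF _ ns(1), of _ f z] fJ freeJ z by (fastforce simp: g_def)
    next
      fix k assume k: "k \<in> K"
      have "{n \<in> N. g n = Some k} = {n \<in> N. shift f ns z n = Some k}"
        by (auto simp: g_def)
      then have "real (card {n \<in> N. g n = Some k}) = real (card {n \<in> N. f n = Some k})
          - of_bool (walk_start f ns z = Some k) + of_bool (z = Some k)"
        using card_shift[OF fin(1) ns, of f z "Some k"] by simp
      moreover have "card {n \<in> N. f n = Some k} < q k" if "z = Some k" "z \<in> free"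
        using that by (auto simp: free_def)
      ultimately show "card {n \<in> N. g n = Some k} \<le> q k"
        using z fq[OF k] by (auto simp: of_bool_def split: if_splits)
    qed
    then have "val g \<le> val f" by (rule opt)
    moreover have "val g = val f - walk_cost f w ns z"
      unfolding val_def sum_shift_weight[OF fin(1) ns, symmetric] by (simp add: g_def)
    ultimately show ?thesis by simp
  qed
  \<comment> \<open>If an agent repeats, the part between two occurrences is a closed walk.
    Splitting it off leaves two shorter walks whose costs add up to the original cost.\<close>
  have walk: "walk_cost f w ns z \<ge> 0"
    if "set ns \<subseteq> N" "z \<in> free \<or> z = walk_start f ns z \<and> z \<in> J" for ns z
    using that
  proof (induction "length ns" arbitrary: ns z rule: less_induct)
    case less
    show ?case
    proof (cases "distinct ns")
      case True
      then show ?thesis using simple less.prems by blast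
    next
      case False
      then obtain xs ys zs n where ns: "ns = xs @ n # ys @ n # zs"
        using not_distinct_decomp[of ns] by auto
      have "walk_cost f w (n # ys) (f n) \<ge> 0"
        using less.prems fJ by (intro less.hyps) (auto simp: ns)
      moreover have "walk_cost f w (xs @ n # zs) z \<ge> 0"
        using less.prems by (intro less.hyps) (auto simp: ns walk_start_append)
      moreover have "walk_cost f w ns z = walk_cost f w (xs @ n # zs) z + walk_cost f w (n # ys) (f n)"
        using walk_cost_append[of f w xs n "ys @ n # zs" z] walk_cost_append[of f w "n # ys" n zs z]
          walk_cost_append[of f w xs n zs z]
        by (simp add: ns)
      ultimately show ?thesis by simp
    qed
  qed
  define S where "S j = {walk_cost f w ns z | ns z. set ns \<subseteq> N \<and> z \<in> free \<and> walk_start f ns z = j}" for j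
  define H where "H j = Inf (S j)" for j
  \<comment> \<open>The empty chain serves a free place. Any other place is a resource filled to its
    positive quota, so one of its agents can be sent to \<open>None\<close>.\<close>
  have S0: "S j \<noteq> {}" if j: "j \<in> J" for j
  proof (cases "j \<in> free")
    case True
    then have "walk_cost f w [] j \<in> S j" unfolding S_def by (intro CollectI exI[of _ "[]"] exI[of _ j]) auto
    then show ?thesis by blast
  next
    case False
    then obtain k where k: "j = Some k" "k \<in> K" "card {n \<in> N. f n = Some k} = q k"
      using j fq by (force simp: J_def free_def)
    then have "{n \<in> N. f n = Some k} \<noteq> {}" using q by fastforce
    then obtain n where "n \<in> N" "f n = j" using k by auto
    then have "walk_cost f w [n] None \<in> S j"
      unfolding S_def by (intro CollectI exI[of _ "[n]"] exI[of _ None]) (auto simp: free_def)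
    then show ?thesis by blast
  qed
  have Spos: "x \<ge> 0" if "x \<in> S j" for x j using that walk by (auto simp: S_def)
  then have bdd: "bdd_below (S j)" for j by (meson bdd_below.I)
  have Hpos: "H j \<ge> 0" if "j \<in> J" for j
    unfolding H_def using S0[OF that] Spos by (rule cInf_greatest)
  \<comment> \<open>Complementary slackness: spare capacity forces price zero.\<close>
  have Hfree: "H j = 0" if "j \<in> free" for j
  proof -
    have "0 \<in> S j" unfolding S_def using that by (intro CollectI exI[of _ "[]"] exI[of _ j]) auto
    then have "H j \<le> 0" unfolding H_def using bdd by (rule cInf_lower)
    then show ?thesis using Hpos[of j] that freeJ by force
  qed
  \<comment> \<open>Prepending \<open>n\<close> to a chain that frees \<open>j\<close> gives one
    that frees \<open>f n\<close>. Hence \<open>f n\<close> is a best place for \<open>n\<close> at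
    the prices \<open>H\<close>, and \<open>u\<close> below is its surplus there.\<close>
  have tri: "w n j - H j \<le> w n (f n) - H (f n)" if n: "n \<in> N" and j: "j \<in> J" for n j
  proof -
    have "H (f n) - w n (f n) + w n j \<le> H j"
      unfolding H_def[of j]
    proof (rule cInf_greatest[OF S0[OF j]])
      fix x assume "x \<in> S j"
      then obtain ns z where x: "x = walk_cost f w ns z" "set ns \<subseteq> N" "z \<in> free" "walk_start f ns z = j"
        by (auto simp: S_def)
      then have "walk_cost f w (n # ns) z \<in> S (f n)"
        unfolding S_def using n by (intro CollectI exI[of _ "n # ns"] exI[of _ z]) auto
      then have "H (f n) \<le> walk_cost f w (n # ns) z"
        unfolding H_def using bdd by (rule cInf_lower)
      then show "H (f n) - w n (f n) + w n j \<le> x" using x by simp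
    qed
    then show ?thesis by simp
  qed
  define u where "u n = w n (f n) - H (f n)" for n
  define h where "h k = H (Some k)" for k
  have HN: "H None = 0" by (rule Hfree) (simp add: free_def)
  \<comment> \<open>Grouped by place, the payments of the agents become the quota term of the dual:
    a full resource has \<open>q k\<close> agents, and all other places have price zero.\<close>
  have "(\<Sum>n\<in>N. H (f n)) = (\<Sum>j\<in>J. \<Sum>n\<in>{n \<in> N. f n = j}. H (f n))"
    by (rule sum.group[symmetric]) (use fin fJ in \<open>auto simp: J_def\<close>)
  also have "\<dots> = (\<Sum>j\<in>J. real (card {n \<in> N. f n = j}) * H j)"
    by (intro sum.cong) auto
  also have "\<dots> = (\<Sum>k\<in>K. real (card {n \<in> N. f n = Some k}) * h k)"
    unfolding J_def using fin by (subst sum.insert) (auto simp: HN sum.reindex h_def)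
  also have "\<dots> = (\<Sum>k\<in>K. real (q k) * h k)"
  proof (rule sum.cong)
    fix k assume k: "k \<in> K"
    show "real (card {n \<in> N. f n = Some k}) * h k = real (q k) * h k"
    proof (cases "card {n \<in> N. f n = Some k} = q k")
      case False
      then have "Some k \<in> free" using fq[OF k] k by (auto simp: free_def)
      then show ?thesis using Hfree by (simp add: h_def)
    qed simp
  qed simp
  finally have sumH: "(\<Sum>n\<in>N. H (f n)) = (\<Sum>k\<in>K. real (q k) * h k)" .
  show thesis
  proof (rule that)
    show "f n \<in> insert None (Some ` K)" if "n \<in> N" for n using fJ[OF that] by (simp add: J_def)
    show "card {n \<in> N. f n = Some k} \<le> q k" if "k \<in> K" for k using fq[OF that] .
    show "0 \<le> u n" if "n \<in> N" for n
      using tri[OF that, of None] HN by (simp add: u_def J_def w_def)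
    show "0 \<le> h k" if "k \<in> K" for k using Hpos[of "Some k"] that by (simp add: h_def J_def)
    show "W n k \<le> u n + h k" if "n \<in> N" "k \<in> K" for n k
      using tri[of n "Some k"] that by (simp add: u_def h_def J_def w_def)
    show "(\<Sum>n\<in>N. case f n of None \<Rightarrow> 0 | Some k \<Rightarrow> W n k) = (\<Sum>n\<in>N. u n) + (\<Sum>k\<in>K. real (q k) * h k)"
      unfolding sumH[symmetric] u_def by (simp add: sum_subtractf w_def)
  qed
qed

section \<open>The linear programs of a batch\<close>

lemma finite_batch: "well_formed I \<Longrightarrow> finite (batch I i)"
  by (simp add: well_formed_def batch_def)

text \<open>The two groupings match the request constraints and the quota constraints of the linear
  program.\<close>

lemma sum_profitable:
  assumes "well_formed I"
  shows "(\<Sum>(n, k)\<in>profitable I p i. g n k) =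
    (\<Sum>n\<in>batch I i. \<Sum>k | (n, k) \<in> profitable I p i. g n k)"
    and "(\<Sum>(n, k)\<in>profitable I p i. g n k) =
    (\<Sum>k\<in>resources I. \<Sum>n | (n, k) \<in> profitable I p i. g n k)"
proof -
  have fin: "finite (batch I i)" "finite (resources I)"
    using assms finite_batch by (auto simp: well_formed_def)
  have "profitable I p i = Sigma (batch I i) (\<lambda>n. {k. (n, k) \<in> profitable I p i})"
    by (auto simp: profitable_def)
  then show "(\<Sum>(n, k)\<in>profitable I p i. g n k) =
      (\<Sum>n\<in>batch I i. \<Sum>k | (n, k) \<in> profitable I p i. g n k)"
    using fin sum.Sigma[of "batch I i" "\<lambda>n. {k. (n, k) \<in> profitable I p i}" g]
    by (simp add: profitable_def)
  have "(\<Sum>(n, k)\<in>profitable I p i. g n k) =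
      (\<Sum>(k, n)\<in>Sigma (resources I) (\<lambda>k. {n. (n, k) \<in> profitable I p i}). g n k)"
    by (rule sum.reindex_bij_witness[of _ prod.swap prod.swap]) (auto simp: profitable_def)
  then show "(\<Sum>(n, k)\<in>profitable I p i. g n k) =
      (\<Sum>k\<in>resources I. \<Sum>n | (n, k) \<in> profitable I p i. g n k)"
    using fin by (subst sum.Sigma) (auto simp: profitable_def)
qed

lemma weak_duality:
  assumes wf: "well_formed I" and x: "primal_feasible I p i x" and uh: "dual_feasible I p i u h"
  shows "primal_value I p i x \<le> dual_value I i u h"
proof -
  let ?P = "profitable I p i"
  have "primal_value I p i x \<le> (\<Sum>(n, k)\<in>?P. (u n + h k) * x n k)"
    unfolding primal_value_def using x uh
    by (intro sum_mono) (auto simp: primal_feasible_def dual_feasible_def intro!: mult_right_mono)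
  also have "\<dots> = (\<Sum>(n, k)\<in>?P. u n * x n k) + (\<Sum>(n, k)\<in>?P. h k * x n k)"
    by (simp add: sum.distrib[symmetric] case_prod_unfold distrib_right)
  also have "(\<Sum>(n, k)\<in>?P. u n * x n k) = (\<Sum>n\<in>batch I i. u n * (\<Sum>k | (n, k) \<in> ?P. x n k))"
    by (simp add: sum_profitable(1)[OF wf] sum_distrib_left)
  also have "(\<Sum>(n, k)\<in>?P. h k * x n k) = (\<Sum>k\<in>resources I. h k * (\<Sum>n | (n, k) \<in> ?P. x n k))"
    by (simp add: sum_profitable(2)[OF wf] sum_distrib_left)
  also have "(\<Sum>n\<in>batch I i. u n * (\<Sum>k | (n, k) \<in> ?P. x n k)) \<le> (\<Sum>n\<in>batch I i. u n * 1)"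
    using x uh by (intro sum_mono mult_left_mono) (auto simp: primal_feasible_def dual_feasible_def)
  also have "(\<Sum>k\<in>resources I. h k * (\<Sum>n | (n, k) \<in> ?P. x n k)) \<le>
      (\<Sum>k\<in>resources I. h k * real (quota I k))"
    using x uh by (intro sum_mono mult_left_mono) (auto simp: primal_feasible_def dual_feasible_def)
  finally show ?thesis by (simp add: dual_value_def mult.commute)
qed

text \<open>Primal and dual solutions of equal value certify each other's optimality, which takes
  the place of total unimodularity.\<close>

lemma strong_duality_integral:
  assumes wf: "well_formed I"
  obtains x u h where "primal_feasible I p i x" "\<And>n k. x n k \<in> \<int>"
    "dual_feasible I p i u h" "primal_value I p i x = dual_value I i u h"
proof -
  let ?P = "profitable I p i"
  \<comment> \<open>Unprofitable pairs get weight 0: the assignment may use them, but they have no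
    variable in the linear program and contribute no value.\<close>
  define W where "W n k = (if (n, k) \<in> ?P then reduced_reward I p n k else 0)" for n k
  have fin: "finite (batch I i)" "finite (resources I)"
    and q: "\<And>k. k \<in> resources I \<Longrightarrow> quota I k > 0"
    using wf finite_batch by (auto simp: well_formed_def)
  from fin q show thesis
  proof (rule assignment_duality[where W = W and q = "quota I"])
    fix f :: "nat \<Rightarrow> nat option" and u h
    assume f: "\<And>n. n \<in> batch I i \<Longrightarrow> f n \<in> insert None (Some ` resources I)"
        "\<And>k. k \<in> resources I \<Longrightarrow> card {n \<in> batch I i. f n = Some k} \<le> quota I k"
      and uh: "\<And>n. n \<in> batch I i \<Longrightarrow> 0 \<le> u n" "\<And>k. k \<in> resources I \<Longrightarrow> 0 \<le> h k"
        "\<And>n k. n \<in> batch I i \<Longrightarrow> k \<in> resources I \<Longrightarrow> W n k \<le> u n + h k"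
      and val: "(\<Sum>n\<in>batch I i. case f n of None \<Rightarrow> 0 | Some k \<Rightarrow> W n k) =
        (\<Sum>n\<in>batch I i. u n) + (\<Sum>k\<in>resources I. real (quota I k) * h k)"
    define x where "x n k = (of_bool (f n = Some k) :: real)" for n k
    have finP: "finite {n. (n, k) \<in> ?P}" "finite {k. (n, k) \<in> ?P}" for n k
      using fin by (auto simp: profitable_def)
    show thesis
    proof (rule that)
      show "primal_feasible I p i x"
        unfolding primal_feasible_def
      proof (intro conjI ballI)
        fix k assume k: "k \<in> resources I"
        have "(\<Sum>n | (n, k) \<in> ?P. x n k) \<le> (\<Sum>n\<in>batch I i. x n k)"
          using fin by (intro sum_mono2) (auto simp: profitable_def x_def)
        also have "\<dots> = real (card {n \<in> batch I i. f n = Some k})"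
          using fin by (simp add: x_def Int_def)
        also have "\<dots> \<le> real (quota I k)" using f(2)[OF k] by simp
        finally show "(\<Sum>n | (n, k) \<in> ?P. x n k) \<le> real (quota I k)" .
      next
        fix n
        have "(\<Sum>k | (n, k) \<in> ?P. x n k) = real (card ({k. (n, k) \<in> ?P} \<inter> {k. f n = Some k}))"
          using finP by (simp add: x_def)
        also have "\<dots> \<le> real (card (set_option (f n)))"
          by (intro of_nat_mono card_mono) auto
        also have "\<dots> \<le> 1" by (cases "f n") auto
        finally show "(\<Sum>k | (n, k) \<in> ?P. x n k) \<le> 1" .
      qed (auto simp: x_def)
      show "x n k \<in> \<int>" for n k by (simp add: x_def)
      have "reduced_reward I p n k \<le> u n + h k" if "(n, k) \<in> ?P" for n k
        using uh(3)[of n k] that by (simp add: W_def profitable_def)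
      then show "dual_feasible I p i u h"
        using uh(1,2) by (auto simp: dual_feasible_def)
      have "primal_value I p i x =
          (\<Sum>n\<in>batch I i. \<Sum>k | (n, k) \<in> ?P. reduced_reward I p n k * x n k)"
        unfolding primal_value_def by (rule sum_profitable(1)[OF wf])
      also have "\<dots> = (\<Sum>n\<in>batch I i. case f n of None \<Rightarrow> 0 | Some k \<Rightarrow> W n k)"
      proof (rule sum.cong)
        fix n
        show "(\<Sum>k | (n, k) \<in> ?P. reduced_reward I p n k * x n k) =
            (case f n of None \<Rightarrow> 0 | Some k \<Rightarrow> W n k)"
        proof (cases "f n")
          case (Some k)
          have "(\<Sum>j | (n, j) \<in> ?P. reduced_reward I p n j * x n j) =
              (\<Sum>j | (n, j) \<in> ?P. if j = k then reduced_reward I p n j else 0)"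
            by (rule sum.cong) (auto simp: x_def Some)
          then show ?thesis using finP by (simp add: W_def Some)
        qed (simp add: x_def)
      qed simp
      finally show "primal_value I p i x = dual_value I i u h" using val by (simp add: dual_value_def)
    qed
  qed
qed

text \<open>A step may take any optimal solutions. Weak duality and one pair of equal value squeeze
  the two optima together.\<close>

lemma optimal_values_eq:
  assumes "well_formed I" "primal_optimal I p i x" "dual_optimal I p i u h"
  shows "primal_value I p i x = dual_value I i u h"
proof -
  obtain y v g where y: "primal_feasible I p i y" "\<And>n k. y n k \<in> \<int>"
    and vg: "dual_feasible I p i v g" and eq: "primal_value I p i y = dual_value I i v g"
    by (rule strong_duality_integral[OF assms(1), of p i]) blast
  have "primal_value I p i y \<le> primal_value I p i x"
    using assms(2) y by (simp add: primal_optimal_def)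
  moreover have "dual_value I i u h \<le> dual_value I i v g"
    using assms(3) vg by (simp add: dual_optimal_def)
  moreover have "primal_value I p i x \<le> dual_value I i u h"
    using assms by (intro weak_duality) (simp_all add: primal_optimal_def dual_optimal_def)
  ultimately show ?thesis using eq by simp
qed

section \<open>Existence of runs\<close>

lemma alg_step_exists:
  assumes wf: "well_formed I"
  shows "\<exists>\<sigma>'. alg_step I i \<sigma> \<sigma>'"
proof -
  let ?P = "profitable I (price \<sigma>) i"
  obtain x u h where xuh: "primal_feasible I (price \<sigma>) i x" "\<And>n k. x n k \<in> \<int>"
    "dual_feasible I (price \<sigma>) i u h" "primal_value I (price \<sigma>) i x = dual_value I i u h"
    by (rule strong_duality_integral[OF wf, of "price \<sigma>" i]) blast
  have "finite ?P"
    by (rule finite_subset[of _ "batch I i \<times> resources I"])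
      (use wf finite_batch[OF wf] in \<open>auto simp: profitable_def well_formed_def\<close>)
  then have "finite {(n, k) \<in> ?P. x n k = 1}"
    by (rule rev_finite_subset) auto
  then obtain ps where ps: "distinct ps" "set ps = {(n, k) \<in> ?P. x n k = 1}"
    using finite_distinct_list[OF \<open>finite {(n, k) \<in> ?P. x n k = 1}\<close>] by blast
  have "primal_optimal I (price \<sigma>) i x"
    using xuh weak_duality[OF wf _ xuh(3)] by (simp add: primal_optimal_def)
  moreover have "dual_optimal I (price \<sigma>) i u h"
    using xuh weak_duality[OF wf xuh(1)] by (simp add: dual_optimal_def)
  ultimately show ?thesis
    unfolding alg_step_def using xuh(2) ps by blast
qed

text \<open>Rules out that the claims about all outputs hold vacuously.\<close>

lemma alg_output_exists:
  assumes "well_formed I"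
  shows "\<exists>x. alg_output I x"
proof -
  have "\<exists>\<sigma>. alg_run I i \<sigma>" for i
    by (induction i) (use alg_step_exists[OF assms] in \<open>blast intro: alg_run.intros\<close>)+
  then show ?thesis by (auto simp: alg_output_def)
qed

section \<open>Prices and loads\<close>

text \<open>Only requests occupying all of \<open>A\<close> count, so for nonnegative
  \<open>x\<close> the load shrinks as \<open>A\<close> grows; for a singleton it is the usual load
  of a slot. Larger blocks serve the feasibility proof.\<close>

definition load :: "mkp_instance \<Rightarrow> (nat \<Rightarrow> nat \<Rightarrow> real) \<Rightarrow> nat \<Rightarrow> nat set \<Rightarrow> real" where
  "load I x k A = (\<Sum>n | n \<in> requests I \<and> A \<subseteq> slots I n k. demand I n k * x n k)"

text \<open>By the choice of \<open>beta\<close>, an update multiplies price plus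
  \<open>theta_min\<close> by \<open>mu\<close>. The factors combine into one exponential, whatever
  the order of processing.\<close>

lemma fold_price_update:
  assumes "distinct ps"
  shows "fold (price_update I) ps p k t + theta_min I k = (p k t + theta_min I k) *
    exp ((\<Sum>n | (n, k) \<in> set ps \<and> t \<in> slots I n k. demand I n k) * gam I k / capacity I k)"
  using assms
proof (induction ps arbitrary: p)
  case (Cons a ps)
  obtain m j where a: "a = (m, j)" by force
  let ?S = "\<lambda>ps. {n. (n, k) \<in> set ps \<and> t \<in> slots I n k}"
  have IH: "fold (price_update I) (a # ps) p k t + theta_min I k =
      (price_update I a p k t + theta_min I k) *
        exp ((\<Sum>n\<in>?S ps. demand I n k) * gam I k / capacity I k)"
    using Cons by simp
  show ?case
  proof (cases "j = k \<and> t \<in> slots I m k")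
    case True
    have "finite (?S ps)"
      by (rule finite_subset[of _ "fst ` set ps"]) (auto intro: rev_image_eqI)
    moreover have "?S (a # ps) = insert m (?S ps)" "m \<notin> ?S ps"
      using True a Cons.prems by auto
    ultimately have "(\<Sum>n\<in>?S (a # ps). demand I n k) = demand I m k + (\<Sum>n\<in>?S ps. demand I n k)"
      by simp
    moreover have "price_update I a p k t + theta_min I k = mu I m k * (p k t + theta_min I k)"
      using True by (simp add: a price_update_def beta_def algebra_simps)
    moreover have "exp ((demand I m k + c) * gam I k / capacity I k) =
        mu I m k * exp (c * gam I k / capacity I k)" for c
      by (simp add: mu_def distrib_right add_divide_distrib exp_add)
    ultimately show ?thesis unfolding IH by (simp only: mult_ac)
  next
    case False
    then have "?S (a # ps) = ?S ps" using a by auto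
    moreover have "price_update I a p k t = p k t" using False by (auto simp: a price_update_def)
    ultimately show ?thesis unfolding IH by simp
  qed
qed simp

text \<open>From \<open>exp x <= 1 + x + x^2\<close> on the unit interval. It linearises the price
  growth of a batch, where the exponent is at most \<open>ln 2\<close>.\<close>

lemma exp_le_one_plus_double:
  fixes x :: real
  assumes "0 \<le> x" "x \<le> ln 2"
  shows "exp x \<le> 1 + 2 * x"
proof -
  have "ln 2 \<le> (1 :: real)" using ln_le_minus_one[of 2] by simp
  then have "x\<^sup>2 \<le> x" using assms by (simp add: power2_eq_square mult_left_le)
  then show ?thesis using exp_bound[of x] assms \<open>ln 2 \<le> 1\<close> by simp
qed

text \<open>A step in terms of the indicator \<open>y\<close> of the newly accepted pairs. Extension
  by zero to unprofitable pairs lets the sums run over the whole batch and all resources, and the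
  price change becomes multiplicative.\<close>

lemma alg_step_elim:
  assumes wf: "well_formed I" and step: "alg_step I i \<sigma> \<sigma>'"
  obtains y u h where
    "\<And>n k. y n k \<in> {0, 1}"
    "\<And>n k. y n k \<noteq> 0 \<Longrightarrow> (n, k) \<in> profitable I (price \<sigma>) i"
    "\<And>n. n \<in> batch I i \<Longrightarrow> (\<Sum>k\<in>resources I. y n k) \<le> 1"
    "\<And>k. k \<in> resources I \<Longrightarrow> (\<Sum>n\<in>batch I i. y n k) \<le> real (quota I k)"
    "dual_feasible I (price \<sigma>) i u h"
    "(\<Sum>n\<in>batch I i. \<Sum>k\<in>resources I. reduced_reward I (price \<sigma>) n k * y n k) = dual_value I i u h"
    "\<And>n k. sol \<sigma>' n k = (if y n k = 1 then 1 else sol \<sigma> n k)"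
    "\<And>k t. k \<in> resources I \<Longrightarrow> price \<sigma>' k t + theta_min I k =
       (price \<sigma> k t + theta_min I k) * exp (load I y k {t} * gam I k / capacity I k)"
    "req_dual \<sigma>' = (\<lambda>n. if n \<in> batch I i then u n else req_dual \<sigma> n)"
    "res_dual \<sigma>' = (\<lambda>k j. if k \<in> resources I \<and> j = i then h k else res_dual \<sigma> k j)"
proof -
  let ?P = "profitable I (price \<sigma>) i"
  obtain x u h ps where
    popt: "primal_optimal I (price \<sigma>) i x" and int: "\<forall>(n, k)\<in>?P. x n k \<in> \<int>"
    and dopt: "dual_optimal I (price \<sigma>) i u h"
    and ps: "distinct ps" "set ps = {(n, k) \<in> ?P. x n k = 1}"
    and \<sigma>': "\<sigma>' = \<lparr>sol = \<lambda>n k. if (n, k) \<in> set ps then 1 else sol \<sigma> n k,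
              price = fold (price_update I) ps (price \<sigma>),
              req_dual = \<lambda>n. if n \<in> batch I i then u n else req_dual \<sigma> n,
              res_dual = \<lambda>k j. if k \<in> resources I \<and> j = i then h k else res_dual \<sigma> k j\<rparr>"
    using step unfolding alg_step_def by blast
  have fin: "finite (batch I i)" "finite (resources I)" "finite (requests I)"
    using wf finite_batch by (auto simp: well_formed_def)
  have P: "?P \<subseteq> batch I i \<times> resources I" by (auto simp: profitable_def)
  have B: "batch I i \<subseteq> requests I" by (auto simp: batch_def)
  have feas: "primal_feasible I (price \<sigma>) i x" using popt by (simp add: primal_optimal_def)
  define y where "y n k = (of_bool ((n, k) \<in> set ps) :: real)" for n k
  \<comment> \<open>The request constraint bounds each integral variable by 1, so it is 0 or 1 and
    no accepted amount is lost in \<open>y\<close>.\<close>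
  have yx: "y n k = x n k" if nk: "(n, k) \<in> ?P" for n k
  proof -
    have "x n k \<le> (\<Sum>k | (n, k) \<in> ?P. x n k)"
      by (rule member_le_sum)
        (use nk feas fin P in \<open>auto simp: primal_feasible_def intro: finite_subset[of _ "resources I"]\<close>)
    also have "\<dots> \<le> 1" using feas nk P by (auto simp: primal_feasible_def)
    finally have "x n k \<le> 1" .
    moreover have "0 \<le> x n k" using feas nk by (auto simp: primal_feasible_def)
    moreover have "x n k \<in> \<int>" using int nk by auto
    then obtain z where "x n k = of_int z" by (rule Ints_cases)
    ultimately have "z = 0 \<or> z = 1" by auto
    then show ?thesis using nk \<open>x n k = of_int z\<close> by (auto simp: y_def ps)
  qed
  have y0: "y n k = 0" if "(n, k) \<notin> ?P" for n k
    using that by (simp add: y_def ps)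
  have sumk: "(\<Sum>k\<in>resources I. g k * y n k) = (\<Sum>k | (n, k) \<in> ?P. g k * x n k)" for n and g :: "nat \<Rightarrow> real"
    by (rule sum.mono_neutral_cong_right) (use fin P y0 yx in auto)
  have sumn: "(\<Sum>n\<in>batch I i. y n k) = (\<Sum>n | (n, k) \<in> ?P. x n k)" for k
    by (rule sum.mono_neutral_cong_right) (use fin P y0 yx in auto)
  show thesis
  proof (rule that)
    show "y n k \<in> {0, 1}" for n k by (simp add: y_def)
    show "(n, k) \<in> ?P" if "y n k \<noteq> 0" for n k using y0 that by blast
    show "(\<Sum>k\<in>resources I. y n k) \<le> 1" if "n \<in> batch I i" for n
      using sumk[of "\<lambda>_. 1" n] feas that by (simp add: primal_feasible_def)
    show "(\<Sum>n\<in>batch I i. y n k) \<le> real (quota I k)" if "k \<in> resources I" for k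
      using sumn feas that by (simp add: primal_feasible_def)
    show "dual_feasible I (price \<sigma>) i u h" using dopt by (simp add: dual_optimal_def)
    show "(\<Sum>n\<in>batch I i. \<Sum>k\<in>resources I. reduced_reward I (price \<sigma>) n k * y n k) =
        dual_value I i u h"
      unfolding sumk using optimal_values_eq[OF wf popt dopt]
        sum_profitable(1)[OF wf, where g = "\<lambda>n k. reduced_reward I (price \<sigma>) n k * x n k"]
      by (simp only: primal_value_def)
    show "sol \<sigma>' n k = (if y n k = 1 then 1 else sol \<sigma> n k)" for n k
      by (simp add: \<sigma>' y_def)
    show "price \<sigma>' k t + theta_min I k =
       (price \<sigma> k t + theta_min I k) * exp (load I y k {t} * gam I k / capacity I k)" for k t
    proof -
      have "load I y k {t} = (\<Sum>n | (n, k) \<in> set ps \<and> t \<in> slots I n k. demand I n k)"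
        unfolding load_def
        by (rule sum.mono_neutral_cong_right) (use fin P B in \<open>auto simp: y_def ps\<close>)
      then show ?thesis using fold_price_update[OF ps(1)] by (simp add: \<sigma>')
    qed
  qed (simp_all add: \<sigma>')
qed

section \<open>Standing assumptions and invariants of a run\<close>

locale small_demand_instance =
  fixes I :: mkp_instance
  assumes adm: "admissible I" and small: "small_demands I"
begin

lemma wf: "well_formed I"
  using adm by (simp add: admissible_def)

lemma fin: "finite (resources I)" "finite (requests I)" "finite (batch I i)"
  using wf finite_batch by (auto simp: well_formed_def)

lemma capacity_pos: "k \<in> resources I \<Longrightarrow> capacity I k > 0"
  and quota_pos: "k \<in> resources I \<Longrightarrow> quota I k > 0"
  using wf by (auto simp: well_formed_def)

lemma demand_pos: "n \<in> requests I \<Longrightarrow> k \<in> resources I \<Longrightarrow> demand I n k > 0"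
  and reward_nonneg: "n \<in> requests I \<Longrightarrow> k \<in> resources I \<Longrightarrow> reward I n k \<ge> 0"
  and duration_pos: "n \<in> requests I \<Longrightarrow> k \<in> resources I \<Longrightarrow> duration I n k \<ge> 1"
  and slots_subset: "n \<in> requests I \<Longrightarrow> k \<in> resources I \<Longrightarrow> slots I n k \<subseteq> time_slots I"
  and arrival_slot: "n \<in> requests I \<Longrightarrow> arrival I n \<in> time_slots I"
  using wf by (auto simp: well_formed_def)

lemma theta_min_pos: "k \<in> resources I \<Longrightarrow> theta_min I k > 0"
  using adm by (auto simp: admissible_def density_assumption_def)

lemma theta_ratio_ge_1: "k \<in> resources I \<Longrightarrow> theta_ratio I k \<ge> 1"
  using adm by (auto simp: admissible_def density_assumption_def theta_ratio_def)

lemma dur_ratio_ge_1: "k \<in> resources I \<Longrightarrow> dur_ratio I k \<ge> 1"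
  using adm by (auto simp: admissible_def duration_assumption_def dur_ratio_def)

lemma gam_pos:
  assumes "k \<in> resources I"
  shows "gam I k > 0"
proof -
  have "0 \<le> theta_ratio I k * dur_ratio I k"
    using theta_ratio_ge_1[OF assms] dur_ratio_ge_1[OF assms] by (intro mult_nonneg_nonneg) auto
  then show ?thesis by (simp add: gam_def mult.assoc)
qed

lemma load_nonneg:
  assumes "k \<in> resources I" "\<And>n k. x n k \<ge> 0"
  shows "load I x k A \<ge> 0"
  unfolding load_def using assms demand_pos by (intro sum_nonneg) (simp add: less_imp_le)

lemma load_antimono:
  assumes "k \<in> resources I" "\<And>n k. x n k \<ge> 0" "A \<subseteq> B"
  shows "load I x k B \<le> load I x k A"
  unfolding load_def using assms demand_pos fin
  by (intro sum_mono2) (auto simp: less_imp_le)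

lemma load_add: "load I (\<lambda>n k. x n k + y n k) k A = load I x k A + load I y k A"
  by (simp add: load_def distrib_left sum.distrib)

text \<open>At most \<open>quota\<close> requests are accepted, each of demand at most
  \<open>capacity * ln 2 / (quota * gam)\<close>, and the quota cancels. Thus one batch raises the
  price exponent by at most \<open>ln 2\<close>.\<close>

lemma batch_load_le:
  assumes k: "k \<in> resources I" and y: "\<And>n k. y n k \<in> {0, 1}" "\<And>n k. y n k \<noteq> 0 \<Longrightarrow> n \<in> batch I i"
    and quota: "(\<Sum>n\<in>batch I i. y n k) \<le> real (quota I k)"
  shows "load I y k A \<le> capacity I k * ln 2 / gam I k"
proof -
  define e where "e = capacity I k * ln 2 / (real (quota I k) * gam I k)"
  have y0: "y n k \<ge> 0" for n k using y(1)[of n k] by auto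
  have e0: "e \<ge> 0" using capacity_pos[OF k] gam_pos[OF k] by (simp add: e_def)
  have e: "demand I n k \<le> e" if "n \<in> requests I" for n
    using adm small k that unfolding admissible_def demand_assumption_def small_demands_def e_def
    by (meson order.trans)
  have "load I y k A \<le> (\<Sum>n | n \<in> requests I \<and> A \<subseteq> slots I n k. e * y n k)"
    unfolding load_def using e y0 by (intro sum_mono mult_right_mono) auto
  also have "\<dots> \<le> (\<Sum>n\<in>requests I. e * y n k)"
    using fin y0 e0 by (intro sum_mono2) (auto intro!: mult_nonneg_nonneg)
  also have "\<dots> = (\<Sum>n\<in>batch I i. e * y n k)"
    using fin y(2) by (intro sum.mono_neutral_right) (auto simp: batch_def)
  also have "\<dots> = e * (\<Sum>n\<in>batch I i. y n k)"
    by (simp add: sum_distrib_left)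
  also have "\<dots> \<le> e * real (quota I k)" using quota e0 by (rule mult_left_mono)
  also have "\<dots> = capacity I k * ln 2 / gam I k"
    using quota_pos[OF k] by (simp add: e_def)
  finally show ?thesis .
qed

text \<open>The clause on arrivals serves the induction: the old solution vanishes on the new batch,
  so \<open>y\<close> alone decides there.\<close>

lemma run_solution:
  assumes "alg_run I i \<sigma>"
  shows "(\<forall>n k. sol \<sigma> n k \<in> {0, 1}) \<and>
    (\<forall>n k. sol \<sigma> n k \<noteq> 0 \<longrightarrow> arrival I n \<le> i) \<and>
    (\<forall>n\<in>requests I. (\<Sum>k\<in>resources I. sol \<sigma> n k) \<le> 1) \<and>
    (\<forall>k\<in>resources I. \<forall>j. (\<Sum>n\<in>batch I j. sol \<sigma> n k) \<le> real (quota I k))"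
  using assms
proof (induction rule: alg_run.induct)
  case init
  show ?case by (simp add: init_state_def)
next
  case (step i \<sigma> \<sigma>')
  from wf step.hyps(2) show ?case
  proof (rule alg_step_elim)
    fix y
    assume y: "\<And>n k. y n k \<in> {0, 1}"
      "\<And>n k. y n k \<noteq> 0 \<Longrightarrow> (n, k) \<in> profitable I (price \<sigma>) (Suc i)"
      "\<And>n. n \<in> batch I (Suc i) \<Longrightarrow> (\<Sum>k\<in>resources I. y n k) \<le> 1"
      "\<And>k. k \<in> resources I \<Longrightarrow> (\<Sum>n\<in>batch I (Suc i). y n k) \<le> real (quota I k)"
      and sol': "\<And>n k. sol \<sigma>' n k = (if y n k = 1 then 1 else sol \<sigma> n k)"
    have yb: "y n k = 0" if "n \<notin> batch I (Suc i)" for n k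
      using y(2)[of n k] that by (auto simp: profitable_def)
    have solb: "sol \<sigma> n k = 0" if "n \<in> batch I (Suc i)" for n k
      using step.IH that by (fastforce simp: batch_def)
    have s0: "sol \<sigma>' n k = sol \<sigma> n k" if "n \<notin> batch I (Suc i)" for n k
      using that yb sol' by simp
    have s1: "sol \<sigma>' n k = y n k" if "n \<in> batch I (Suc i)" for n k
      using that solb sol' y(1)[of n k] by auto
    show ?case
    proof (intro conjI allI ballI impI)
      show "sol \<sigma>' n k \<in> {0, 1}" for n k using step.IH sol' by simp
      show "arrival I n \<le> Suc i" if "sol \<sigma>' n k \<noteq> 0" for n k
      proof (cases "n \<in> batch I (Suc i)")
        case False
        then show ?thesis using step.IH that s0 le_SucI by metis
      qed (simp add: batch_def)
      show "(\<Sum>k\<in>resources I. sol \<sigma>' n k) \<le> 1" if "n \<in> requests I" for n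
        using that step.IH y(3) by (cases "n \<in> batch I (Suc i)") (simp_all add: s0 s1)
      show "(\<Sum>n\<in>batch I j. sol \<sigma>' n k) \<le> real (quota I k)" if k: "k \<in> resources I" for k j
      proof (cases "j = Suc i")
        case False
        then have "(\<Sum>n\<in>batch I j. sol \<sigma>' n k) = (\<Sum>n\<in>batch I j. sol \<sigma> n k)"
          by (intro sum.cong s0) (auto simp: batch_def)
        then show ?thesis using step.IH k by simp
      qed (use k y(4) s1 in simp)
    qed
  qed
qed

lemma run_step_sol:
  assumes "alg_run I i \<sigma>" "\<And>n k. y n k \<in> {0, 1}"
    "\<And>n k. y n k \<noteq> 0 \<Longrightarrow> (n, k) \<in> profitable I (price \<sigma>) (Suc i)"
    "\<And>n k. sol \<sigma>' n k = (if y n k = 1 then 1 else sol \<sigma> n k)"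
  shows "sol \<sigma>' = (\<lambda>n k. sol \<sigma> n k + y n k)"
proof (intro ext)
  fix n k
  have "sol \<sigma> n k = 0" if "y n k \<noteq> 0"
    using run_solution[OF assms(1)] assms(3)[OF that]
    by (fastforce simp: profitable_def batch_def)
  then show "sol \<sigma>' n k = sol \<sigma> n k + y n k" using assms(2)[of n k] assms(4) by auto
qed

text \<open>Loads of successive batches add up, hence their exponential factors multiply.\<close>

lemma run_price:
  assumes "alg_run I i \<sigma>" "k \<in> resources I"
  shows "price \<sigma> k t + theta_min I k = theta_min I k * exp (load I (sol \<sigma>) k {t} * gam I k / capacity I k)"
  using assms
proof (induction rule: alg_run.induct)
  case init
  show ?case by (simp add: init_state_def load_def)
next
  case (step i \<sigma> \<sigma>')
  from wf step.hyps(2) show ?case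
  proof (rule alg_step_elim)
    fix y
    assume y: "\<And>n k. y n k \<in> {0, 1}"
      "\<And>n k. y n k \<noteq> 0 \<Longrightarrow> (n, k) \<in> profitable I (price \<sigma>) (Suc i)"
      and sol': "\<And>n k. sol \<sigma>' n k = (if y n k = 1 then 1 else sol \<sigma> n k)"
      and price': "\<And>k t. k \<in> resources I \<Longrightarrow> price \<sigma>' k t + theta_min I k =
       (price \<sigma> k t + theta_min I k) * exp (load I y k {t} * gam I k / capacity I k)"
    have "sol \<sigma>' = (\<lambda>n k. sol \<sigma> n k + y n k)"
      using run_step_sol[OF step.hyps(1) y sol'] .
    then have "load I (sol \<sigma>') k {t} * gam I k / capacity I k =
        load I (sol \<sigma>) k {t} * gam I k / capacity I k + load I y k {t} * gam I k / capacity I k"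
      by (simp add: load_add distrib_right add_divide_distrib)
    then show ?case
      using price'[OF step.prems] step.IH[OF step.prems] by (simp only: exp_add mult.assoc)
  qed
qed

lemma run_sol_nonneg: "alg_run I i \<sigma> \<Longrightarrow> sol \<sigma> n k \<ge> 0"
  using run_solution[of i \<sigma>] by (metis insert_iff order.refl singletonD zero_le_one)

text \<open>A request covering \<open>A\<close> covers each of its slots, so the load of the block
  is a lower bound for the load in every slot of it.\<close>

lemma run_price_ge:
  assumes run: "alg_run I i \<sigma>" and k: "k \<in> resources I"
    and c: "c \<le> load I (sol \<sigma>) k A" "t \<in> A"
  shows "theta_min I k * (exp (c * gam I k / capacity I k) - 1) \<le> price \<sigma> k t"
proof -
  have "c \<le> load I (sol \<sigma>) k {t}"
    using c load_antimono[OF k, of "sol \<sigma>" "{t}" A] run_sol_nonneg[OF run] by simp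
  then have "exp (c * gam I k / capacity I k) \<le> exp (load I (sol \<sigma>) k {t} * gam I k / capacity I k)"
    using gam_pos[OF k] capacity_pos[OF k] by (simp add: divide_right_mono)
  then have "theta_min I k * exp (c * gam I k / capacity I k) \<le> price \<sigma> k t + theta_min I k"
    unfolding run_price[OF run k] using theta_min_pos[OF k] by simp
  then show ?thesis by (simp add: algebra_simps)
qed

lemma run_price_nonneg:
  assumes "alg_run I i \<sigma>" "k \<in> resources I"
  shows "price \<sigma> k t \<ge> 0"
  using run_price_ge[OF assms, of 0 "{t}" t] load_nonneg[OF assms(2), of "sol \<sigma>" "{t}"]
    run_sol_nonneg[OF assms(1)] by simp

section \<open>Feasibility\<close>

lemma reward_le:
  assumes "n \<in> requests I" "k \<in> resources I"
  shows "reward I n k \<le> demand I n k * (theta_max I k * dur_max I k)"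
\<comment> \<open>The density bound is available for positive rewards only.\<close>
proof (cases "reward I n k = 0")
  case True
  then show ?thesis
    using adm assms demand_pos[OF assms]
    unfolding admissible_def density_assumption_def duration_assumption_def
    by (fastforce intro!: mult_nonneg_nonneg)
next
  case False
  then have "reward I n k > 0" using reward_nonneg[OF assms] by simp
  then have *: "theta I n k \<le> theta_max I k" "theta_min I k \<le> theta I n k"
    "real (duration I n k) \<le> dur_max I k"
    using adm assms by (auto simp: admissible_def density_assumption_def duration_assumption_def)
  have "reward I n k = demand I n k * (theta I n k * real (duration I n k))"
    using demand_pos[OF assms] duration_pos[OF assms] by (simp add: theta_def)
  also have "\<dots> \<le> demand I n k * (theta_max I k * dur_max I k)"
    using * theta_min_pos[OF assms(2)] demand_pos[OF assms] by (intro mult_left_mono mult_mono) auto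
  finally show ?thesis .
qed

text \<open>
  If the requests occupying all of a set of at least \<open>dur_min / 2\<close> slots already use nearly half of the
  capacity, then the prices on this set alone exceed every reward.
\<close>

lemma not_profitable_if_loaded:
  assumes run: "alg_run I i \<sigma>" and nk: "n \<in> requests I" "k \<in> resources I"
    and A: "A \<subseteq> slots I n k" "dur_min I k / 2 \<le> real (card A)"
    and full: "capacity I k / 2 - capacity I k * ln 2 / gam I k \<le> load I (sol \<sigma>) k A"
  shows "reduced_reward I (price \<sigma>) n k \<le> 0"
proof -
  let ?r = "theta_ratio I k * dur_ratio I k" and ?g = "gam I k" and ?C = "capacity I k"
  have pos: "?g > 0" "?C > 0" "theta_min I k > 0" "demand I n k > 0" "?r \<ge> 0"
    using gam_pos capacity_pos theta_min_pos demand_pos nk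
      mult_nonneg_nonneg[of "theta_ratio I k" "dur_ratio I k"] theta_ratio_ge_1[OF nk(2)] dur_ratio_ge_1[OF nk(2)]
    by auto
  have dm: "dur_min I k > 0"
    using adm nk by (auto simp: admissible_def duration_assumption_def)
  \<comment> \<open>The definition of \<open>gam\<close> is tuned to this point: half the capacity
    gives the exponent \<open>ln (2 + 4 * r)\<close>, and the room kept for one more batch costs
    \<open>ln 2\<close>, leaving the factor \<open>1 + 2 * r\<close>.\<close>
  have "(?C / 2 - ?C * ln 2 / ?g) * ?g / ?C = ?g / 2 - ln 2"
    using pos by (simp add: field_simps)
  also have "?g / 2 = ln (2 + 4 * ?r)" by (simp add: gam_def mult.assoc)
  finally have "(?C / 2 - ?C * ln 2 / ?g) * ?g / ?C = ln (2 + 4 * ?r) - ln 2" .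
  then have "exp ((?C / 2 - ?C * ln 2 / ?g) * ?g / ?C) = 1 + 2 * ?r"
    using pos by (simp add: exp_diff)
  then have p: "2 * (theta_min I k * ?r) \<le> price \<sigma> k t" if "t \<in> A" for t
    using run_price_ge[OF run nk(2) full that] by (simp add: algebra_simps)
  \<comment> \<open>The largest possible reward per unit of demand is paid by
    \<open>dur_min / 2\<close> slots at the price just found.\<close>
  have "theta_max I k * dur_max I k = dur_min I k / 2 * (2 * (theta_min I k * ?r))"
    using pos dm by (simp add: theta_ratio_def dur_ratio_def)
  also have "\<dots> \<le> real (card A) * (2 * (theta_min I k * ?r))"
    using A(2) pos by (intro mult_right_mono) auto
  also have "\<dots> \<le> (\<Sum>t\<in>A. price \<sigma> k t)"
    using sum_mono[of A "\<lambda>_. 2 * (theta_min I k * ?r)", OF p] by simp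
  also have "\<dots> \<le> (\<Sum>t\<in>slots I n k. price \<sigma> k t)"
    using A(1) run_price_nonneg[OF run nk(2)] by (intro sum_mono2) (auto simp: slots_def)
  finally have "demand I n k * (theta_max I k * dur_max I k) \<le>
      demand I n k * (\<Sum>t\<in>slots I n k. price \<sigma> k t)"
    using pos by simp
  then show ?thesis using reward_le[OF nk] by (simp add: reduced_reward_def)
qed

text \<open>If a step adds to this load, some accepted request covers \<open>A\<close> and was
  profitable at the old prices. The old load was therefore below the threshold, and one batch adds
  at most the gap to half the capacity.\<close>

lemma run_half_load:
  assumes "alg_run I i \<sigma>" and k: "k \<in> resources I" and A: "dur_min I k / 2 \<le> real (card A)"
  shows "load I (sol \<sigma>) k A \<le> capacity I k / 2"
  using assms(1)
proof (induction rule: alg_run.induct)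
  case init
  show ?case using capacity_pos[OF k] by (simp add: init_state_def load_def)
next
  case (step i \<sigma> \<sigma>')
  from wf step.hyps(2) show ?case
  proof (rule alg_step_elim)
    fix y
    assume y: "\<And>n k. y n k \<in> {0, 1}"
      "\<And>n k. y n k \<noteq> 0 \<Longrightarrow> (n, k) \<in> profitable I (price \<sigma>) (Suc i)"
      "\<And>k. k \<in> resources I \<Longrightarrow> (\<Sum>n\<in>batch I (Suc i). y n k) \<le> real (quota I k)"
      and sol': "\<And>n k. sol \<sigma>' n k = (if y n k = 1 then 1 else sol \<sigma> n k)"
    have "sol \<sigma>' = (\<lambda>n k. sol \<sigma> n k + y n k)"
      using run_step_sol[OF step.hyps(1) y(1,2) sol'] .
    then have eq: "load I (sol \<sigma>') k A = load I (sol \<sigma>) k A + load I y k A"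
      by (simp add: load_add)
    show ?case
    proof (cases "\<exists>n\<in>requests I. A \<subseteq> slots I n k \<and> y n k \<noteq> 0")
      case True
      then obtain n where n: "n \<in> requests I" "A \<subseteq> slots I n k" "y n k \<noteq> 0" by blast
      then have "reduced_reward I (price \<sigma>) n k > 0"
        using y(2) by (auto simp: profitable_def)
      then have "load I (sol \<sigma>) k A < capacity I k / 2 - capacity I k * ln 2 / gam I k"
        using not_profitable_if_loaded[OF step.hyps(1) n(1) k n(2) A] by linarith
      moreover have "load I y k A \<le> capacity I k * ln 2 / gam I k"
      proof (rule batch_load_le[where i = "Suc i"])
        show "n \<in> batch I (Suc i)" if "y n k \<noteq> 0" for n k
          using y(2)[OF that] by (simp add: profitable_def)
      qed (use k y in auto)
      ultimately show ?thesis using eq by linarith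
    next
      case False
      then have "load I y k A = 0" by (auto simp: load_def intro!: sum.neutral)
      then show ?thesis using eq step.IH by simp
    qed
  qed
qed

text \<open>
  A request occupying slot \<open>t\<close> occupies at least \<open>dur_min / 2\<close> consecutive slots starting or ending
  with \<open>t\<close>.
\<close>

lemma run_capacity:
  assumes run: "alg_run I i \<sigma>" and k: "k \<in> resources I"
  shows "load I (sol \<sigma>) k {t} \<le> capacity I k"
proof -
  define m where "m = nat \<lceil>dur_min I k / 2\<rceil>"
  have dm: "dur_min I k > 0"
    using adm k by (auto simp: admissible_def duration_assumption_def)
  have m: "dur_min I k / 2 \<le> real m" "real m < dur_min I k / 2 + 1"
    using dm unfolding m_def by linarith+
  define R L where "R = {t..<t + m}" and "L = {t + 1 - m..<t + 1}"
  \<comment> \<open>Otherwise at most \<open>m - 1\<close> slots lie on each side, with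
    \<open>t\<close> counted twice, so the duration is at most \<open>2 * m - 3\<close>; but it
    exceeds \<open>2 * m - 2\<close>.\<close>
  have side: "R \<subseteq> slots I n k \<or> m \<le> t + 1 \<and> L \<subseteq> slots I n k"
    if n: "n \<in> requests I" "t \<in> slots I n k" for n
  proof -
    have "dur_min I k \<le> real (duration I n k)"
      using adm k n by (auto simp: admissible_def duration_assumption_def)
    then have "2 * m < duration I n k + 2" using m(2) by linarith
    then have "t + m \<le> start I n k + duration I n k \<or> start I n k + m \<le> t + 1"
      using n(2) by (auto simp: slots_def)
    then show ?thesis using n(2) by (auto simp: slots_def R_def L_def)
  qed
  have nonneg: "0 \<le> demand I n k * sol \<sigma> n k" if "n \<in> requests I" for n
    using demand_pos[OF that k] run_sol_nonneg[OF run] by simp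
  have R: "load I (sol \<sigma>) k R \<le> capacity I k / 2"
    using m by (intro run_half_load[OF run k]) (simp add: R_def)
  show ?thesis
  proof (cases "m \<le> t + 1")
    case True
    have L: "load I (sol \<sigma>) k L \<le> capacity I k / 2"
      using m True by (intro run_half_load[OF run k]) (simp add: L_def)
    have "load I (sol \<sigma>) k {t} \<le>
        (\<Sum>n\<in>{n. n \<in> requests I \<and> R \<subseteq> slots I n k} \<union> {n. n \<in> requests I \<and> L \<subseteq> slots I n k}.
          demand I n k * sol \<sigma> n k)"
      unfolding load_def using fin nonneg side by (intro sum_mono2) auto
    also have "\<dots> \<le> load I (sol \<sigma>) k R + load I (sol \<sigma>) k L"
      unfolding load_def using fin nonneg by (subst sum_Un) (auto intro!: sum_nonneg)
    finally show ?thesis using R L by simp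
  next
    case False
    then have "load I (sol \<sigma>) k {t} \<le> load I (sol \<sigma>) k R"
      unfolding load_def using fin nonneg side by (intro sum_mono2) auto
    then show ?thesis using R capacity_pos[OF k] by simp
  qed
qed

theorem output_feasible:
  assumes "alg_output I x"
  shows "feasible I x"
proof -
  obtain \<sigma> where run: "alg_run I (horizon I) \<sigma>" and x: "x = sol \<sigma>"
    using assms by (auto simp: alg_output_def)
  show ?thesis
    using run_solution[OF run] run_capacity[OF run] by (simp add: feasible_def x load_def)
qed

section \<open>Competitiveness\<close>

text \<open>Growing prices keep the dual constraints of earlier requests satisfied.\<close>

lemma step_price_mono:
  assumes run: "alg_run I i \<sigma>" and k: "k \<in> resources I" and y: "\<And>n k. y n k \<in> {0, 1}"
    and price': "price \<sigma>' k t + theta_min I k =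
       (price \<sigma> k t + theta_min I k) * exp (load I y k {t} * gam I k / capacity I k)"
  shows "price \<sigma> k t \<le> price \<sigma>' k t"
proof -
  have "y n k \<ge> 0" for n k using y[of n k] by auto
  then have "1 \<le> exp (load I y k {t} * gam I k / capacity I k)"
    using load_nonneg[OF k, of y] gam_pos[OF k] capacity_pos[OF k] by simp
  moreover have "0 \<le> price \<sigma> k t + theta_min I k"
    using run_price_nonneg[OF run k, of t] theta_min_pos[OF k] by simp
  ultimately have "price \<sigma> k t + theta_min I k \<le> price \<sigma>' k t + theta_min I k"
    unfolding price' by (metis mult.right_neutral mult_left_mono)
  then show ?thesis by simp
qed

text \<open>The constraints of a request are met on its arrival by the dual of its batch; for
  unprofitable pairs they hold since the variables are nonnegative. Later steps only raise
  prices.\<close>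

lemma run_dual_feasible:
  assumes "alg_run I i \<sigma>"
  shows "(\<forall>n\<in>requests I. arrival I n \<le> i \<longrightarrow> 0 \<le> req_dual \<sigma> n \<and>
      (\<forall>k\<in>resources I. reward I n k \<le> req_dual \<sigma> n + res_dual \<sigma> k (arrival I n) +
        demand I n k * (\<Sum>t\<in>slots I n k. price \<sigma> k t))) \<and>
    (\<forall>k\<in>resources I. \<forall>j. 0 \<le> res_dual \<sigma> k j)"
  using assms
proof (induction rule: alg_run.induct)
  case init
  \<comment> \<open>Time slots start at 1, so no request has arrived by time 0.\<close>
  show ?case using arrival_slot by (fastforce simp: init_state_def time_slots_def)
next
  case (step i \<sigma> \<sigma>')
  from wf step.hyps(2) show ?case
  proof (rule alg_step_elim)
    fix y u h
    assume y: "\<And>n k. y n k \<in> {0, 1}"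
      and dual: "dual_feasible I (price \<sigma>) (Suc i) u h"
      and price': "\<And>k t. k \<in> resources I \<Longrightarrow> price \<sigma>' k t + theta_min I k =
       (price \<sigma> k t + theta_min I k) * exp (load I y k {t} * gam I k / capacity I k)"
      and req': "req_dual \<sigma>' = (\<lambda>n. if n \<in> batch I (Suc i) then u n else req_dual \<sigma> n)"
      and res': "res_dual \<sigma>' =
        (\<lambda>k j. if k \<in> resources I \<and> j = Suc i then h k else res_dual \<sigma> k j)"
    have uh: "n \<in> batch I (Suc i) \<Longrightarrow> 0 \<le> u n" "k \<in> resources I \<Longrightarrow> 0 \<le> h k" for n k
      using dual by (auto simp: dual_feasible_def)
    have mono: "demand I n k * (\<Sum>t\<in>slots I n k. price \<sigma> k t) \<le>
        demand I n k * (\<Sum>t\<in>slots I n k. price \<sigma>' k t)"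
      if "n \<in> requests I" "k \<in> resources I" for n k
      using step_price_mono[OF step.hyps(1) that(2) y price'[OF that(2)]] demand_pos[OF that]
      by (intro mult_left_mono sum_mono) auto
    show ?case
    proof (intro conjI ballI allI impI)
      fix n assume n: "n \<in> requests I" "arrival I n \<le> Suc i"
      show "0 \<le> req_dual \<sigma>' n"
        using n step.IH uh by (auto simp: req' batch_def)
      fix k assume k: "k \<in> resources I"
      show "reward I n k \<le> req_dual \<sigma>' n + res_dual \<sigma>' k (arrival I n) +
        demand I n k * (\<Sum>t\<in>slots I n k. price \<sigma>' k t)"
      proof (cases "n \<in> batch I (Suc i)")
        case True
        have "reduced_reward I (price \<sigma>) n k \<le> u n + h k"
        proof (cases "(n, k) \<in> profitable I (price \<sigma>) (Suc i)")
          case True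
          then show ?thesis using dual by (auto simp: dual_feasible_def)
        next
          case False
          then have "reduced_reward I (price \<sigma>) n k \<le> 0"
            using True k by (auto simp: profitable_def)
          then show ?thesis using uh(1)[OF True] uh(2)[OF k] by simp
        qed
        then show ?thesis
          using True k mono[OF n(1) k] by (simp add: req' res' reduced_reward_def batch_def)
      next
        case False
        then have "arrival I n \<le> i" "arrival I n \<noteq> Suc i" using n by (auto simp: batch_def)
        then show ?thesis
          using False n(1) k mono[OF n(1) k] step.IH by (fastforce simp: req' res')
      qed
    next
      fix k j assume "k \<in> resources I"
      then show "0 \<le> res_dual \<sigma>' k j" using step.IH uh by (simp add: res')
    qed
  qed
qed

section \<open>Growth of the dual cost\<close>

lemma sum_slots_swap:
  assumes "k \<in> resources I"
  shows "(\<Sum>n\<in>requests I. \<Sum>t\<in>slots I n k. g n t) =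
    (\<Sum>t\<in>time_slots I. \<Sum>n | n \<in> requests I \<and> t \<in> slots I n k. g n t)"
proof -
  have "(\<Sum>n\<in>requests I. \<Sum>t\<in>slots I n k. g n t) =
      (\<Sum>n\<in>requests I. \<Sum>t | t \<in> time_slots I \<and> t \<in> slots I n k. g n t)"
    using slots_subset[OF _ assms] by (intro sum.cong) auto
  also have "\<dots> = (\<Sum>t\<in>time_slots I. \<Sum>n | n \<in> requests I \<and> t \<in> slots I n k. g n t)"
    using fin by (intro sum.swap_restrict) (auto simp: time_slots_def)
  finally show ?thesis .
qed

text \<open>The objective of the dual of the offline linear program, restricted to batches up to
  \<open>i\<close>: \<open>req_dual\<close> belongs to the request constraints,
  \<open>res_dual\<close> to the quotas and \<open>price\<close> to the capacities.\<close>

definition dual_cost :: "nat \<Rightarrow> alg_state \<Rightarrow> real" where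
  "dual_cost i \<sigma> = (\<Sum>n | n \<in> requests I \<and> arrival I n \<le> i. req_dual \<sigma> n) +
    (\<Sum>k\<in>resources I. \<Sum>j=1..i. real (quota I k) * res_dual \<sigma> k j) +
    (\<Sum>k\<in>resources I. \<Sum>t\<in>time_slots I. capacity I k * price \<sigma> k t)"

lemma solution_value_add:
  "solution_value I (\<lambda>n k. x n k + y n k) = solution_value I x + solution_value I y"
  by (simp add: solution_value_def distrib_left sum.distrib)

text \<open>The factor 4 is a product of two factors 2: one from linearising the exponential, the
  other from charging price plus \<open>theta_min\<close> over the slots of an accepted request,
  where each summand costs at most its reward.\<close>

lemma step_price_cost:
  assumes run: "alg_run I i \<sigma>" and k: "k \<in> resources I" and G: "gam I k \<le> G"
    and y: "\<And>n k. y n k \<in> {0, 1}"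
      "\<And>n k. y n k \<noteq> 0 \<Longrightarrow> (n, k) \<in> profitable I (price \<sigma>) j"
      "(\<Sum>n\<in>batch I j. y n k) \<le> real (quota I k)"
    and price': "\<And>t. price \<sigma>' k t + theta_min I k =
       (price \<sigma> k t + theta_min I k) * exp (load I y k {t} * gam I k / capacity I k)"
  shows "(\<Sum>t\<in>time_slots I. capacity I k * price \<sigma>' k t) \<le>
    (\<Sum>t\<in>time_slots I. capacity I k * price \<sigma> k t) + 4 * G * (\<Sum>n\<in>requests I. reward I n k * y n k)"
proof -
  let ?q = "\<lambda>t. price \<sigma> k t + theta_min I k"
  have pos: "gam I k > 0" "capacity I k > 0" "theta_min I k > 0"
    using gam_pos capacity_pos theta_min_pos k by auto
  have y0: "y n k \<ge> 0" for n k using y(1)[of n k] by auto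
  have yb: "n \<in> batch I j" if "y n k \<noteq> 0" for n k
    using y(2)[OF that] by (simp add: profitable_def)
  have q0: "?q t \<ge> 0" for t using run_price_nonneg[OF run k, of t] pos by simp
  have slot: "capacity I k * price \<sigma>' k t \<le> capacity I k * price \<sigma> k t + 2 * G * (load I y k {t} * ?q t)" for t
  proof -
    let ?z = "load I y k {t} * gam I k / capacity I k"
    have l0: "load I y k {t} \<ge> 0" using load_nonneg[OF k, of y] y0 by blast
    have "load I y k {t} \<le> capacity I k * ln 2 / gam I k"
      using k y(1) yb y(3) by (rule batch_load_le)
    then have "?z \<le> ln 2" using pos by (simp add: field_simps)
    then have "exp ?z \<le> 1 + 2 * ?z" using l0 pos by (intro exp_le_one_plus_double) auto
    then have "price \<sigma>' k t + theta_min I k \<le> ?q t * (1 + 2 * ?z)"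
      unfolding price' using q0 by (intro mult_left_mono)
    then have "price \<sigma>' k t \<le> price \<sigma> k t + 2 * ?z * ?q t" by (simp add: algebra_simps)
    then have "capacity I k * price \<sigma>' k t \<le> capacity I k * (price \<sigma> k t + 2 * ?z * ?q t)"
      using pos by (intro mult_left_mono) auto
    also have "\<dots> = capacity I k * price \<sigma> k t + 2 * gam I k * (load I y k {t} * ?q t)"
      using pos by (simp add: field_simps)
    also have "\<dots> \<le> capacity I k * price \<sigma> k t + 2 * G * (load I y k {t} * ?q t)"
      using G l0 q0 by (intro add_left_mono mult_right_mono mult_left_mono) auto
    finally show ?thesis .
  qed
  have req: "(\<Sum>t\<in>slots I n k. demand I n k * y n k * ?q t) \<le> 2 * (reward I n k * y n k)"
    if n: "n \<in> requests I" for n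
  proof (cases "y n k = 0")
    case False
    then have "y n k = 1" and r: "reduced_reward I (price \<sigma>) n k > 0"
      using y(1)[of n k] y(2) by (auto simp: profitable_def)
    have less: "demand I n k * (\<Sum>t\<in>slots I n k. price \<sigma> k t) < reward I n k"
      using r by (simp add: reduced_reward_def)
    \<comment> \<open>With nonnegative prices, profitability makes the reward positive, so the lower
      density bound applies.\<close>
    have "0 \<le> demand I n k * (\<Sum>t\<in>slots I n k. price \<sigma> k t)"
      using demand_pos[OF n k] run_price_nonneg[OF run k] by (intro mult_nonneg_nonneg sum_nonneg) auto
    then have "theta_min I k \<le> theta I n k"
      using less adm n k by (auto simp: admissible_def density_assumption_def)
    then have "demand I n k * (real (duration I n k) * theta_min I k) \<le> reward I n k"
      using demand_pos[OF n k] duration_pos[OF n k] by (simp add: theta_def field_simps)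
    moreover have "(\<Sum>t\<in>slots I n k. demand I n k * y n k * ?q t) =
        demand I n k * (\<Sum>t\<in>slots I n k. price \<sigma> k t) + demand I n k * (real (duration I n k) * theta_min I k)"
      by (simp add: \<open>y n k = 1\<close> sum.distrib distrib_left sum_distrib_left slots_def)
    ultimately show ?thesis using less \<open>y n k = 1\<close> by simp
  qed simp
  have "(\<Sum>t\<in>time_slots I. load I y k {t} * ?q t) =
      (\<Sum>t\<in>time_slots I. \<Sum>n | n \<in> requests I \<and> t \<in> slots I n k. demand I n k * y n k * ?q t)"
    by (simp add: load_def sum_distrib_right)
  also have "\<dots> = (\<Sum>n\<in>requests I. \<Sum>t\<in>slots I n k. demand I n k * y n k * ?q t)"
    by (rule sum_slots_swap[OF k, symmetric])
  also have "\<dots> \<le> 2 * (\<Sum>n\<in>requests I. reward I n k * y n k)"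
    unfolding sum_distrib_left[of 2] using req by (rule sum_mono)
  finally have total: "(\<Sum>t\<in>time_slots I. load I y k {t} * ?q t) \<le>
      2 * (\<Sum>n\<in>requests I. reward I n k * y n k)" .
  have "(\<Sum>t\<in>time_slots I. capacity I k * price \<sigma>' k t) \<le>
      (\<Sum>t\<in>time_slots I. capacity I k * price \<sigma> k t + 2 * G * (load I y k {t} * ?q t))"
    by (rule sum_mono) (rule slot)
  also have "\<dots> = (\<Sum>t\<in>time_slots I. capacity I k * price \<sigma> k t) +
      2 * G * (\<Sum>t\<in>time_slots I. load I y k {t} * ?q t)"
    by (simp add: sum.distrib sum_distrib_left)
  also have "\<dots> \<le> (\<Sum>t\<in>time_slots I. capacity I k * price \<sigma> k t) +
      2 * G * (2 * (\<Sum>n\<in>requests I. reward I n k * y n k))"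
    using total G pos by (intro add_left_mono mult_left_mono) auto
  finally show ?thesis by simp
qed

text \<open>The summand 1 pays for the batch duals, the summand \<open>4 * G\<close> for the
  prices.\<close>

lemma run_dual_cost:
  assumes "alg_run I i \<sigma>" and G: "\<And>k. k \<in> resources I \<Longrightarrow> gam I k \<le> G"
  shows "dual_cost i \<sigma> \<le> (1 + 4 * G) * solution_value I (sol \<sigma>)"
  using assms(1)
proof (induction rule: alg_run.induct)
  case init
  show ?case by (simp add: init_state_def dual_cost_def solution_value_def)
next
  case (step i \<sigma> \<sigma>')
  from wf step.hyps(2) show ?case
  proof (rule alg_step_elim)
    fix y u h
    assume y: "\<And>n k. y n k \<in> {0, 1}"
      "\<And>n k. y n k \<noteq> 0 \<Longrightarrow> (n, k) \<in> profitable I (price \<sigma>) (Suc i)"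
      "\<And>k. k \<in> resources I \<Longrightarrow> (\<Sum>n\<in>batch I (Suc i). y n k) \<le> real (quota I k)"
      and val: "(\<Sum>n\<in>batch I (Suc i). \<Sum>k\<in>resources I. reduced_reward I (price \<sigma>) n k * y n k) =
        dual_value I (Suc i) u h"
      and sol': "\<And>n k. sol \<sigma>' n k = (if y n k = 1 then 1 else sol \<sigma> n k)"
      and price': "\<And>k t. k \<in> resources I \<Longrightarrow> price \<sigma>' k t + theta_min I k =
       (price \<sigma> k t + theta_min I k) * exp (load I y k {t} * gam I k / capacity I k)"
      and req': "req_dual \<sigma>' = (\<lambda>n. if n \<in> batch I (Suc i) then u n else req_dual \<sigma> n)"
      and res': "res_dual \<sigma>' =
        (\<lambda>k j. if k \<in> resources I \<and> j = Suc i then h k else res_dual \<sigma> k j)"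
    have y0: "y n k \<ge> 0" for n k using y(1)[of n k] by auto
    have "sol \<sigma>' = (\<lambda>n k. sol \<sigma> n k + y n k)"
      using run_step_sol[OF step.hyps(1) y(1,2) sol'] .
    then have V: "solution_value I (sol \<sigma>') = solution_value I (sol \<sigma>) + solution_value I y"
      by (simp add: solution_value_add)
    have "{n. n \<in> requests I \<and> arrival I n \<le> Suc i} =
        {n. n \<in> requests I \<and> arrival I n \<le> i} \<union> batch I (Suc i)"
      by (auto simp: batch_def)
    then have "(\<Sum>n | n \<in> requests I \<and> arrival I n \<le> Suc i. req_dual \<sigma>' n) =
        (\<Sum>n | n \<in> requests I \<and> arrival I n \<le> i. req_dual \<sigma>' n) + (\<Sum>n\<in>batch I (Suc i). req_dual \<sigma>' n)"
      using fin by (simp add: sum.union_disjoint batch_def disjoint_iff)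
    also have "(\<Sum>n | n \<in> requests I \<and> arrival I n \<le> i. req_dual \<sigma>' n) =
        (\<Sum>n | n \<in> requests I \<and> arrival I n \<le> i. req_dual \<sigma> n)"
      by (rule sum.cong) (auto simp: req' batch_def)
    also have "(\<Sum>n\<in>batch I (Suc i). req_dual \<sigma>' n) = (\<Sum>n\<in>batch I (Suc i). u n)"
      by (simp add: req')
    finally have req: "(\<Sum>n | n \<in> requests I \<and> arrival I n \<le> Suc i. req_dual \<sigma>' n) =
        (\<Sum>n | n \<in> requests I \<and> arrival I n \<le> i. req_dual \<sigma> n) + (\<Sum>n\<in>batch I (Suc i). u n)" .
    have res: "(\<Sum>k\<in>resources I. \<Sum>j=1..Suc i. real (quota I k) * res_dual \<sigma>' k j) =
        (\<Sum>k\<in>resources I. \<Sum>j=1..i. real (quota I k) * res_dual \<sigma> k j) +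
        (\<Sum>k\<in>resources I. real (quota I k) * h k)"
      unfolding sum.distrib[symmetric] by (rule sum.cong) (auto simp: res' intro!: sum.cong)
    \<comment> \<open>The batch duals cost exactly the accepted reduced reward, which is at most the
      accepted reward.\<close>
    have "dual_value I (Suc i) u h \<le> (\<Sum>n\<in>batch I (Suc i). \<Sum>k\<in>resources I. reward I n k * y n k)"
      unfolding val[symmetric]
    proof (intro sum_mono mult_right_mono y0)
      fix n k assume nk: "n \<in> batch I (Suc i)" "k \<in> resources I"
      then have "0 \<le> demand I n k * (\<Sum>t\<in>slots I n k. price \<sigma> k t)"
        using demand_pos[of n k] run_price_nonneg[OF step.hyps(1), of k]
        by (intro mult_nonneg_nonneg sum_nonneg) (auto simp: batch_def less_imp_le)
      then show "reduced_reward I (price \<sigma>) n k \<le> reward I n k"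
        by (simp add: reduced_reward_def)
    qed
    also have "\<dots> = solution_value I y"
      unfolding solution_value_def
    proof (rule sum.mono_neutral_left)
      show "\<forall>n\<in>requests I - batch I (Suc i). (\<Sum>k\<in>resources I. reward I n k * y n k) = 0"
        using y(2) by (fastforce simp: profitable_def intro!: sum.neutral)
    qed (auto simp: fin batch_def)
    finally have D: "dual_value I (Suc i) u h \<le> solution_value I y" .
    have "(\<Sum>k\<in>resources I. \<Sum>t\<in>time_slots I. capacity I k * price \<sigma>' k t) \<le>
        (\<Sum>k\<in>resources I. (\<Sum>t\<in>time_slots I. capacity I k * price \<sigma> k t) +
          4 * G * (\<Sum>n\<in>requests I. reward I n k * y n k))"
      by (rule sum_mono) (rule step_price_cost[OF step.hyps(1) _ G y price'])
    also have "\<dots> = (\<Sum>k\<in>resources I. \<Sum>t\<in>time_slots I. capacity I k * price \<sigma> k t) +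
        4 * G * (\<Sum>k\<in>resources I. \<Sum>n\<in>requests I. reward I n k * y n k)"
      by (simp add: sum.distrib sum_distrib_left)
    also have "(\<Sum>k\<in>resources I. \<Sum>n\<in>requests I. reward I n k * y n k) = solution_value I y"
      unfolding solution_value_def by (rule sum.swap)
    finally have P: "(\<Sum>k\<in>resources I. \<Sum>t\<in>time_slots I. capacity I k * price \<sigma>' k t) \<le>
        (\<Sum>k\<in>resources I. \<Sum>t\<in>time_slots I. capacity I k * price \<sigma> k t) + 4 * G * solution_value I y" .
    have "dual_cost (Suc i) \<sigma>' \<le> dual_cost i \<sigma> + dual_value I (Suc i) u h + 4 * G * solution_value I y"
      using P unfolding dual_cost_def req res dual_value_def by linarith
    also have "\<dots> \<le> (1 + 4 * G) * solution_value I (sol \<sigma>')"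
      unfolding V using D step.IH by (simp add: algebra_simps)
    finally show ?case .
  qed
qed

text \<open>Weak duality for the offline problem: dual feasibility bounds each reward, and the
  request, quota and capacity constraints of \<open>x\<close> then bound the three parts of the
  cost.\<close>

lemma feasible_value_le_dual_cost:
  assumes run: "alg_run I (horizon I) \<sigma>" and x: "feasible I x"
  shows "solution_value I x \<le> dual_cost (horizon I) \<sigma>"
proof -
  have x0: "0 \<le> x n k" if "n \<in> requests I" "k \<in> resources I" for n k
    using x that by (fastforce simp: feasible_def)
  have arr: "arrival I n \<le> horizon I" if "n \<in> requests I" for n
    using arrival_slot[OF that] by (simp add: time_slots_def)
  have u0: "0 \<le> req_dual \<sigma> n" if "n \<in> requests I" for n
    using run_dual_feasible[OF run] that arr by blast
  have h0: "0 \<le> res_dual \<sigma> k j" if "k \<in> resources I" for k j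
    using run_dual_feasible[OF run] that by blast
  have split: "(req_dual \<sigma> n + res_dual \<sigma> k (arrival I n) +
        demand I n k * (\<Sum>t\<in>slots I n k. price \<sigma> k t)) * x n k =
      req_dual \<sigma> n * x n k + res_dual \<sigma> k (arrival I n) * x n k +
        (\<Sum>t\<in>slots I n k. price \<sigma> k t * (demand I n k * x n k))" for n k
    by (simp add: algebra_simps sum_distrib_left)
  have "solution_value I x \<le> (\<Sum>n\<in>requests I. \<Sum>k\<in>resources I. (req_dual \<sigma> n + res_dual \<sigma> k (arrival I n) +
        demand I n k * (\<Sum>t\<in>slots I n k. price \<sigma> k t)) * x n k)"
    unfolding solution_value_def using run_dual_feasible[OF run] x0 arr
    by (intro sum_mono mult_right_mono) auto
  also have "\<dots> = (\<Sum>n\<in>requests I. req_dual \<sigma> n * (\<Sum>k\<in>resources I. x n k)) +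
      (\<Sum>k\<in>resources I. \<Sum>n\<in>requests I. res_dual \<sigma> k (arrival I n) * x n k) +
      (\<Sum>k\<in>resources I. \<Sum>n\<in>requests I. \<Sum>t\<in>slots I n k. price \<sigma> k t * (demand I n k * x n k))"
    unfolding split
    by (simp add: sum.distrib sum_distrib_left sum.swap[of _ "requests I" "resources I"])
  also have "(\<Sum>n\<in>requests I. req_dual \<sigma> n * (\<Sum>k\<in>resources I. x n k)) \<le>
      (\<Sum>n\<in>requests I. req_dual \<sigma> n * 1)"
    using u0 x by (intro sum_mono mult_left_mono) (auto simp: feasible_def)
  also have "(\<Sum>n\<in>requests I. req_dual \<sigma> n * 1) =
      (\<Sum>n | n \<in> requests I \<and> arrival I n \<le> horizon I. req_dual \<sigma> n)"
    using arr by (intro sum.cong) auto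
  also have "(\<Sum>k\<in>resources I. \<Sum>n\<in>requests I. res_dual \<sigma> k (arrival I n) * x n k) \<le>
      (\<Sum>k\<in>resources I. \<Sum>j=1..horizon I. real (quota I k) * res_dual \<sigma> k j)"
  proof (rule sum_mono)
    fix k assume k: "k \<in> resources I"
    have "(\<Sum>n\<in>requests I. res_dual \<sigma> k (arrival I n) * x n k) =
        (\<Sum>j=1..horizon I. \<Sum>n | n \<in> requests I \<and> arrival I n = j. res_dual \<sigma> k (arrival I n) * x n k)"
      using fin arrival_slot by (intro sum.group[symmetric]) (auto simp: time_slots_def)
    also have "\<dots> = (\<Sum>j=1..horizon I. res_dual \<sigma> k j * (\<Sum>n\<in>batch I j. x n k))"
      by (auto simp: batch_def sum_distrib_left intro!: sum.cong)
    also have "\<dots> \<le> (\<Sum>j=1..horizon I. res_dual \<sigma> k j * real (quota I k))"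
      using h0[OF k] x k by (intro sum_mono mult_left_mono) (auto simp: feasible_def time_slots_def)
    finally show "(\<Sum>n\<in>requests I. res_dual \<sigma> k (arrival I n) * x n k) \<le>
        (\<Sum>j=1..horizon I. real (quota I k) * res_dual \<sigma> k j)"
      by (simp add: mult.commute)
  qed
  also have "(\<Sum>k\<in>resources I. \<Sum>n\<in>requests I. \<Sum>t\<in>slots I n k. price \<sigma> k t * (demand I n k * x n k)) \<le>
      (\<Sum>k\<in>resources I. \<Sum>t\<in>time_slots I. capacity I k * price \<sigma> k t)"
  proof (rule sum_mono)
    fix k assume k: "k \<in> resources I"
    have "(\<Sum>n\<in>requests I. \<Sum>t\<in>slots I n k. price \<sigma> k t * (demand I n k * x n k)) =
        (\<Sum>t\<in>time_slots I. price \<sigma> k t * (\<Sum>n | n \<in> requests I \<and> t \<in> slots I n k. demand I n k * x n k))"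
      by (simp add: sum_slots_swap[OF k] sum_distrib_left)
    also have "\<dots> \<le> (\<Sum>t\<in>time_slots I. price \<sigma> k t * capacity I k)"
      using x k run_price_nonneg[OF run k] by (intro sum_mono mult_left_mono) (auto simp: feasible_def)
    finally show "(\<Sum>n\<in>requests I. \<Sum>t\<in>slots I n k. price \<sigma> k t * (demand I n k * x n k)) \<le>
        (\<Sum>t\<in>time_slots I. capacity I k * price \<sigma> k t)"
      by (simp add: mult.commute)
  qed
  finally show ?thesis by (simp add: dual_cost_def)
qed

text \<open>The value depends only on which pairs are accepted, so finitely many values occur and
  the offline maximum is meaningful.\<close>

lemma finite_solution_values: "finite (solution_value I ` {x. feasible I x})"
proof (rule finite_subset)
  let ?U = "requests I \<times> resources I"
  let ?v = "\<lambda>S. solution_value I (\<lambda>n k. of_bool ((n, k) \<in> S))"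
  show "solution_value I ` {x. feasible I x} \<subseteq> ?v ` Pow ?U"
  proof clarify
    fix x assume x: "feasible I x"
    define S where "S = {(n, k) \<in> ?U. x n k = 1}"
    have "x n k = of_bool ((n, k) \<in> S)" if "n \<in> requests I" "k \<in> resources I" for n k
      using x that by (auto simp: S_def feasible_def)
    then have "solution_value I x = ?v S"
      unfolding solution_value_def by (intro sum.cong) simp_all
    moreover have "S \<in> Pow ?U" by (auto simp: S_def)
    ultimately show "solution_value I x \<in> ?v ` Pow ?U" by blast
  qed
  show "finite (?v ` Pow ?U)" using fin by simp
qed

theorem offline_opt_le:
  assumes out: "alg_output I x" and G: "\<And>k. k \<in> resources I \<Longrightarrow> gam I k \<le> G"
  shows "offline_opt I \<le> (1 + 4 * G) * solution_value I x"
proof -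
  obtain \<sigma> where run: "alg_run I (horizon I) \<sigma>" and x: "x = sol \<sigma>"
    using out by (auto simp: alg_output_def)
  have "solution_value I z \<le> (1 + 4 * G) * solution_value I x" if "feasible I z" for z
    using feasible_value_le_dual_cost[OF run that] run_dual_cost[OF run G] by (simp add: x)
  \<comment> \<open>The output itself shows that the maximum is over a nonempty set.\<close>
  moreover have "feasible I x" using output_feasible[OF out] .
  ultimately show ?thesis
    unfolding offline_opt_def using finite_solution_values by (subst Max_le_iff) auto
qed

section \<open>The ratio as a function of the maximal ratios\<close>

lemma gam_le:
  assumes k: "k \<in> resources I"
  shows "gam I k \<le> 2 * ln (2 + 4 * (theta_ratio_max I * dur_ratio_max I))"
proof -
  have "theta_ratio I k \<le> theta_ratio_max I" "dur_ratio I k \<le> dur_ratio_max I"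
    unfolding theta_ratio_max_def dur_ratio_max_def using fin k by (auto intro: Max_ge)
  then have "theta_ratio I k * dur_ratio I k \<le> theta_ratio_max I * dur_ratio_max I"
    using theta_ratio_ge_1[OF k] dur_ratio_ge_1[OF k] by (intro mult_mono) auto
  moreover have "0 \<le> theta_ratio I k * dur_ratio I k"
    using theta_ratio_ge_1[OF k] dur_ratio_ge_1[OF k] by (intro mult_nonneg_nonneg) auto
  ultimately show ?thesis by (simp add: gam_def mult.assoc)
qed

end

lemma ratio_bigo: "(\<lambda>y :: real. 1 + 4 * (2 * ln (2 + 4 * y))) \<in> O[at_top](\<lambda>y. ln y)"
proof (rule bigoI[where c = 17])
  show "\<forall>\<^sub>F y :: real in at_top. norm (1 + 4 * (2 * ln (2 + 4 * y))) \<le> 17 * norm (ln y)"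
    \<comment> \<open>From 6 on, \<open>2 + 4 * y <= 6 * y <= y * y\<close>, so the logarithm is at
      most \<open>2 * ln y\<close>; from \<open>exp 1\<close> on, the constant 1 is at most
      \<open>ln y\<close>. Together this gives 1 + 8 * 2 = 17.\<close>
    using eventually_ge_at_top[of "max 6 (exp 1)"]
  proof eventually_elim
    case (elim y)
    then have y: "y \<ge> 6" "ln y \<ge> 1" by (auto simp: ln_ge_iff)
    then have "6 * y \<le> y * y" by (intro mult_right_mono) auto
    then have "2 + 4 * y \<le> y * y" using y by linarith
    then have "ln (2 + 4 * y) \<le> ln (y * y)" using y by (subst ln_le_cancel_iff) auto
    then have "ln (2 + 4 * y) \<le> 2 * ln y" using y by (simp add: ln_mult)
    moreover have "0 \<le> ln (2 + 4 * y)" using y by simp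
    ultimately show ?case using y by simp
  qed
qed

theorem theorem2:
  shows "(\<forall>I. admissible I \<and> small_demands I \<longrightarrow>
            (\<exists>x. alg_output I x) \<and> (\<forall>x. alg_output I x \<longrightarrow> feasible I x)) \<and>
         (\<exists>\<alpha> :: real \<Rightarrow> real. \<alpha> \<in> O[at_top](\<lambda>y. ln y) \<and>
            (\<forall>y. competitive_ratio
                   {I. admissible I \<and> small_demands I \<and> theta_ratio_max I * dur_ratio_max I = y}
                   (\<alpha> y)))"
\<comment> \<open>The witness is \<open>1 + 4 * G\<close> with the bound from \<open>gam_le\<close>
  as \<open>G\<close>; it depends on the instance only through the product \<open>y\<close>.\<close>
proof (intro conjI allI impI exI[of _ "\<lambda>y. 1 + 4 * (2 * ln (2 + 4 * y))"] ratio_bigo)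
  fix I assume "admissible I \<and> small_demands I"
  then interpret small_demand_instance I by unfold_locales auto
  show "\<exists>x. alg_output I x" using alg_output_exists[OF wf] .
  show "feasible I x" if "alg_output I x" for x using output_feasible[OF that] .
next
  fix y
  show "competitive_ratio {I. admissible I \<and> small_demands I \<and> theta_ratio_max I * dur_ratio_max I = y}
      (1 + 4 * (2 * ln (2 + 4 * y)))"
    unfolding competitive_ratio_def
  proof (intro ballI allI impI)
    fix I x
    assume I: "I \<in> {I. admissible I \<and> small_demands I \<and> theta_ratio_max I * dur_ratio_max I = y}"
      and out: "alg_output I x"
    then interpret small_demand_instance I by unfold_locales auto
    show "offline_opt I \<le> (1 + 4 * (2 * ln (2 + 4 * y))) * solution_value I x"
      using offline_opt_le[OF out, of "2 * ln (2 + 4 * y)"] gam_le I by auto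
  qed
qed

end
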